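(* Let $E$ be a full Hilbert $\mathcal{B}$-module and let $F_1$ and $F_2$ be correspondences from $\mathcal{B}$ to $\mathcal{C}$. Suppose there exists a unitary $u\colon E\odot F_1\to E\odot F_2$ such that $u(a\odot\mathrm{id}_{F_1})=(a\odot\mathrm{id}_{F_2})u$ for all $a\in B^a(E)$, i.e. $u$ is an isomorphism of correspondences from $B^a(E)$ to $\mathcal{C}$. Then the composition $$F_1\to\mathcal{B}\odot F_1\to E^*\odot E\odot F_1\xrightarrow{\ \mathrm{id}_{E^*}\odot u\ }E^*\odot E\odot F_2\to\mathcal{B}\odot F_2\to F_2,$$ in which all unlabelled arrows are the canonical identifications, is the unique isomorphism $u_{F_1,F_2}\colon F_1\to F_2$ (of correspondences from $\mathcal{B}$ to $\mathcal{C}$) such that $\mathrm{id}_E\odot u_{F_1,F_2}=u$. In particular, let $F$ be a Hilbert $\mathcal{C}$-module carrying a strict unital representation $\vartheta\colon B^a(E)\to B^a(F)$, put $F_\vartheta:=E^*\odot F$, and identify $F=E\odot E^*\odot F=E\odot F_\vartheta$ via $x_1\odot x_2^*\odot y\mapsto\vartheta(x_1x_2^* )y$. If $u\colon E\odot F_1\to F=E\odot E^*\odot F$ is an isomorphism of (strict) correspondences from $B^a(E)$ to $\mathcal{C}$, then $u_{F_1,F_\vartheta}\colon F_1\to F_\vartheta$, defined as the composition $$F_1\to\mathcal{B}\odot F_1\to E^*\odot E\odot F_1\xrightarrow{\ \mathrm{id}_{E^*}\odot u\ }E^*\odot E\odot F_\vartheta\to\mathcal{B}\odot F_\vartheta\to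 F_\vartheta,$$ in which all unlabelled arrows are the canonical identifications, is the unique isomorphism such that $\mathrm{id}_E\odot u_{F_1,F_\vartheta}=u$.
   Context: $\mathcal{B},\mathcal{C}$ are $C^*$-algebras. Hilbert modules are right Hilbert $C^*$-modules. $B^a(E)$ is the algebra of adjointable operators on $E$; for $x,y\in E$, $xy^*\in B^a(E)$ is $z\mapsto x\langle y,z\rangle$, and $\mathcal{K}(E)$ is the norm closed span of these. $E$ is full if $\overline{\mathrm{span}}\,\langle E,E\rangle=\mathcal{B}$. A bounded linear map $B^a(E)\to B^a(F)$ is strict if it is strictly continuous on bounded subsets, where the strict topology is that of the multiplier algebra $B^a(E)=M(\mathcal{K}(E))$ (on bounded subsets: the $*$-strong topology). A correspondence from $\mathcal{A}$ to $\mathcal{B}$ is a Hilbert $\mathcal{B}$-module with a nondegenerate left action of $\mathcal{A}$ by adjointable operators; an isomorphism of correspondences is a bilinear unitary. The tensor product $E\odot F$ of a Hilbert $\mathcal{B}$-module (or correspondence from $\mathcal A$ to $\mathcal B$) $E$ and a correspondence $F$ from $\mathcal{B}$ to $\mathcal{C}$ is the Hilbert $\mathcal{C}$-module (correspondence from $\mathcal A$ to $\mathcal C$) generated by elementary tensors with $\langle x\odot y,x'\odot y'\rangle=\langle y,\langle x,x'\rangle y'\rangle$; $E\odot F_i$ is a correspondence from $B^a(E)$ to $\mathcal{C}$ via $a\mapsto a\odot\mathrm{id}_{F_i}$. The dual module $E^*=\{x^*:x\in E\}$ is the correspondence from $\mathcal{B}$ to $B^a(E)$ with $\langle x^*,y^*\rangle=xy^*$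 and $bx^*a=(a^*xb^* )^*$; in $E^*\odot F$ the tensor product is over $B^a(E)$ acting on $F$ via $\vartheta$. Canonical identifications: $\mathcal{B}\odot F_i=F_i$ via $b\odot y\mapsto by$; and, since $E$ is full, $E^*\odot E=\mathcal{B}$ via $x^*\odot x'\mapsto\langle x,x'\rangle$ (as correspondences from $\mathcal{B}$ to $\mathcal{B}$, where $\mathcal{B}$ has inner product $\langle b,b'\rangle=b^*b'$). *)

theory Defs
  imports "HOL-Analysis.Analysis"
begin

section \<open>Complex Banach spaces and C*-algebras\<close>

class complex_banach = banach +
  fixes scaleC :: "complex \<Rightarrow> 'a \<Rightarrow> 'a" (infixr "*\<^sub>C" 75)
  assumes scaleC_add_right: "c *\<^sub>C (x + y) = c *\<^sub>C x + c *\<^sub>C y"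
    and scaleC_add_left: "(c + d) *\<^sub>C x = c *\<^sub>C x + d *\<^sub>C x"
    and scaleC_scaleC: "c *\<^sub>C d *\<^sub>C x = (c * d) *\<^sub>C x"
    and scaleC_of_real: "complex_of_real r *\<^sub>C x = r *\<^sub>R x"
    and norm_scaleC: "norm (c *\<^sub>C x) = cmod c * norm x"

lemma vector_space_scaleC: "vector_space (scaleC :: complex \<Rightarrow> 'a \<Rightarrow> 'a::complex_banach)"
proof
  show "1 *\<^sub>C x = x" for x :: 'a
    using scaleC_of_real[of 1 x] by simp
qed (simp_all add: scaleC_add_right scaleC_add_left scaleC_scaleC)

abbreviation closed_cspan :: "'a::complex_banach set \<Rightarrow> 'a set"
  where "closed_cspan S \<equiv> closure (module.span scaleC S)"

definition clinear_bounded :: "('a::complex_banach \<Rightarrow> 'b::complex_banach) \<Rightarrow> bool"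
  where "clinear_bounded h \<longleftrightarrow> bounded_linear h \<and> (\<forall>c x. h (c *\<^sub>C x) = c *\<^sub>C h x)"

text \<open>C*-algebras need not have a unit.\<close>

class cstar_algebra = complex_banach + real_normed_algebra +
  fixes star :: "'a \<Rightarrow> 'a"
  assumes mult_scaleC_left: "(c *\<^sub>C a) * b = c *\<^sub>C (a * b)"
    and mult_scaleC_right: "a * (c *\<^sub>C b) = c *\<^sub>C (a * b)"
    and star_add: "star (a + b) = star a + star b"
    and star_scaleC: "star (c *\<^sub>C a) = cnj c *\<^sub>C star a"
    and star_mult: "star (a * b) = star b * star a"
    and star_star: "star (star a) = a"
    and cstar_identity: "norm (star a * a) = (norm a)\<^sup>2"

text \<open>
  An algebra acting from the left is either a C*-algebra given as a type or the algebra of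
  adjointable operators on a given module. The latter is only a subset of a type, so algebras
  acting from the left are records with a carrier; the vector space structure and the norm are
  those of the ambient type.
\<close>

record 'a star_alg =
  acarrier :: "'a set"
  amult :: "'a \<Rightarrow> 'a \<Rightarrow> 'a"
  astar :: "'a \<Rightarrow> 'a"

definition whole_algebra :: "'b::cstar_algebra star_alg"
  where "whole_algebra = \<lparr>acarrier = UNIV, amult = (*), astar = star\<rparr>"

section \<open>Hilbert modules and correspondences\<close>

text \<open>
  The coefficient algebra and the underlying Banach space of a Hilbert module are types. The norm
  of the type is required to be the one given by the inner product, so that class
  \<^class>\<open>complex_banach\<close> expresses completeness in that norm.
\<close>

record ('e, 'b) hilbert_mod =
  ract :: "'e \<Rightarrow> 'b \<Rightarrow> 'e"
  ip :: "'e \<Rightarrow> 'e \<Rightarrow> 'b"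

locale hilbert_module =
  fixes E :: "('e::complex_banach, 'b::cstar_algebra, 'z) hilbert_mod_scheme"
  assumes ract_add_left: "ract E (x + y) b = ract E x b + ract E y b"
    and ract_add_right: "ract E x (b + b') = ract E x b + ract E x b'"
    and ract_mult: "ract E x (b * b') = ract E (ract E x b) b'"
    and ract_scaleC_left: "ract E (c *\<^sub>C x) b = c *\<^sub>C ract E x b"
    and ract_scaleC_right: "ract E x (c *\<^sub>C b) = c *\<^sub>C ract E x b"
    and ip_add: "ip E x (y + z) = ip E x y + ip E x z"
    and ip_scaleC: "ip E x (c *\<^sub>C y) = c *\<^sub>C ip E x y"
    and ip_ract: "ip E x (ract E y b) = ip E x y * b"
    and ip_star: "star (ip E x y) = ip E y x"
    and ip_pos: "\<exists>b. ip E x x = star b * b"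
    and ip_definite: "ip E x x = 0 \<Longrightarrow> x = 0"
    and norm_ip: "norm x = sqrt (norm (ip E x x))"

definition full :: "('e::complex_banach, 'b::cstar_algebra, 'z) hilbert_mod_scheme \<Rightarrow> bool"
  where "full E \<longleftrightarrow> closed_cspan {ip E x y | x y. True} = UNIV"

record ('e, 'b, 'a) corr = "('e, 'b) hilbert_mod" +
  lact :: "'a \<Rightarrow> 'e \<Rightarrow> 'e"

locale correspondence = hilbert_module F
  for A :: "'a::complex_banach star_alg"
    and F :: "('f::complex_banach, 'c::cstar_algebra, 'a) corr" +
  assumes lact_add: "\<lbrakk>a \<in> acarrier A; a' \<in> acarrier A\<rbrakk> \<Longrightarrow> lact F (a + a') y = lact F a y + lact F a' y"
    and lact_scaleC: "a \<in> acarrier A \<Longrightarrow> lact F (c *\<^sub>C a) y = c *\<^sub>C lact F a y"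
    and lact_mult: "\<lbrakk>a \<in> acarrier A; a' \<in> acarrier A\<rbrakk> \<Longrightarrow> lact F (amult A a a') y = lact F a (lact F a' y)"
    and lact_star: "a \<in> acarrier A \<Longrightarrow> ip F (lact F a y) y' = ip F y (lact F (astar A a) y')"
    and nondegenerate: "closed_cspan {lact F a y | a y. a \<in> acarrier A} = UNIV"

text \<open>
  A unitary is an inner product preserving surjection; it is automatically linear and a right
  module map, so that \<open>corr_iso\<close> describes the bilinear unitaries.
\<close>

definition unitary :: "('m, 'c, 'y) hilbert_mod_scheme \<Rightarrow> ('n, 'c, 'z) hilbert_mod_scheme \<Rightarrow> ('m \<Rightarrow> 'n) \<Rightarrow> bool"
  where "unitary M N h \<longleftrightarrow> surj h \<and> (\<forall>x y. ip N (h x) (h y) = ip M x y)"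

definition corr_iso :: "'a star_alg \<Rightarrow> ('m, 'c, 'a) corr \<Rightarrow> ('n, 'c, 'a) corr \<Rightarrow> ('m \<Rightarrow> 'n) \<Rightarrow> bool"
  where "corr_iso A M N h \<longleftrightarrow> unitary M N h \<and> (\<forall>a\<in>acarrier A. \<forall>x. h (lact M a x) = lact N a (h x))"

definition self_corr :: "('b::cstar_algebra, 'b, 'b) corr"
  where "self_corr = \<lparr>ract = (*), ip = (\<lambda>b b'. star b * b'), lact = (*)\<rparr>"

section \<open>Adjointable operators\<close>

instantiation blinfun :: (real_normed_vector, complex_banach) complex_banach
begin

lift_definition scaleC_blinfun :: "complex \<Rightarrow> 'a \<Rightarrow>\<^sub>L 'b \<Rightarrow> 'a \<Rightarrow>\<^sub>L 'b" is "\<lambda>c f x. c *\<^sub>C f x"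
proof -
  fix c :: complex and f :: "'a \<Rightarrow> 'b"
  assume f: "bounded_linear f"
  have "c *\<^sub>C r *\<^sub>R x = r *\<^sub>R c *\<^sub>C x" for r and x :: 'b
    by (metis mult.commute scaleC_of_real scaleC_scaleC)
  then have "bounded_linear (\<lambda>x::'b. c *\<^sub>C x)"
    by (intro bounded_linear_intro[where K = "cmod c"])
       (auto simp: scaleC_add_right norm_scaleC)
  then show "bounded_linear (\<lambda>x. c *\<^sub>C f x)"
    using bounded_linear_compose f by blast
qed

instance
proof
  fix c d :: complex and r :: real and f g :: "'a \<Rightarrow>\<^sub>L 'b"
  show "c *\<^sub>C (f + g) = c *\<^sub>C f + c *\<^sub>C g"
    by transfer (simp add: scaleC_add_right)
  show "(c + d) *\<^sub>C f = c *\<^sub>C f + d *\<^sub>C f"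
    by transfer (simp add: scaleC_add_left)
  show "c *\<^sub>C d *\<^sub>C f = (c * d) *\<^sub>C f"
    by transfer (simp add: scaleC_scaleC)
  show "complex_of_real r *\<^sub>C f = r *\<^sub>R f"
    by transfer (simp add: scaleC_of_real)
  have le: "norm (c *\<^sub>C f) \<le> cmod c * norm f" for c and f :: "'a \<Rightarrow>\<^sub>L 'b"
    by (rule norm_blinfun_bound)
       (auto simp: scaleC_blinfun.rep_eq norm_scaleC mult.assoc intro!: mult_left_mono norm_blinfun)
  show "norm (c *\<^sub>C f) = cmod c * norm f"
  proof (cases "c = 0")
    case True
    then show ?thesis using le[of c f] by simp
  next
    case False
    have "inverse c *\<^sub>C c *\<^sub>C x = x" for x :: 'b
      using False scaleC_of_real[of 1 x] by (simp add: scaleC_scaleC)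
    then have "inverse c *\<^sub>C c *\<^sub>C f = f"
      by (intro blinfun_eqI) (simp add: scaleC_blinfun.rep_eq)
    then have "norm f \<le> cmod (inverse c) * norm (c *\<^sub>C f)"
      using le[of "inverse c" "c *\<^sub>C f"] by simp
    then have "cmod c * norm f \<le> norm (c *\<^sub>C f)"
      using False by (simp add: norm_divide field_simps)
    then show ?thesis using le[of c f] by simp
  qed
qed

end

text \<open>
  \<open>adjointables E\<close> is \<open>B\<^sup>a(E)\<close>. Adjointable maps are automatically linear and bounded, so
  they can be taken from the type of bounded operators, whose norm is the operator norm.
\<close>

definition adjointables :: "('e::complex_banach, 'b, 'z) hilbert_mod_scheme \<Rightarrow> ('e \<Rightarrow>\<^sub>L 'e) set"
  where "adjointables E = {a. \<exists>a'::'e \<Rightarrow>\<^sub>L 'e. \<forall>x y. ip E (blinfun_apply a x) y = ip E x (blinfun_apply a' y)}"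

definition adj :: "('e::complex_banach, 'b, 'z) hilbert_mod_scheme \<Rightarrow> ('e \<Rightarrow>\<^sub>L 'e) \<Rightarrow> 'e \<Rightarrow>\<^sub>L 'e"
  where "adj E a = (THE a'. \<forall>x y. ip E (blinfun_apply a x) y = ip E x (blinfun_apply a' y))"

definition adj_algebra :: "('e::complex_banach, 'b, 'z) hilbert_mod_scheme \<Rightarrow> ('e \<Rightarrow>\<^sub>L 'e) star_alg"
  where "adj_algebra E = \<lparr>acarrier = adjointables E, amult = (o\<^sub>L), astar = adj E\<rparr>"

text \<open>
  \<open>rank_one E x y\<close> is \<open>x y\<^sup>*\<close>. The strict topology on \<open>B\<^sup>a(E) = M(K(E))\<close> is the one of the
  seminorms \<open>a \<mapsto> \<parallel>a k\<parallel>\<close> and \<open>a \<mapsto> \<parallel>k a\<parallel>\<close> with \<open>k \<in> K(E) = compacts E\<close>.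
\<close>

definition rank_one :: "('e::complex_banach, 'b, 'z) hilbert_mod_scheme \<Rightarrow> 'e \<Rightarrow> 'e \<Rightarrow> 'e \<Rightarrow>\<^sub>L 'e"
  where "rank_one E x y = Blinfun (\<lambda>z. ract E x (ip E y z))"

definition compacts :: "('e::complex_banach, 'b, 'z) hilbert_mod_scheme \<Rightarrow> ('e \<Rightarrow>\<^sub>L 'e) set"
  where "compacts E = closed_cspan {rank_one E x y | x y. True}"

definition strict_topology :: "('e::complex_banach, 'b, 'z) hilbert_mod_scheme \<Rightarrow> ('e \<Rightarrow>\<^sub>L 'e) topology"
  where "strict_topology E = topology_generated_by
    ({{a \<in> adjointables E. norm ((a - a\<^sub>0) o\<^sub>L k) < e} | a\<^sub>0 k e.
        a\<^sub>0 \<in> adjointables E \<and> k \<in> compacts E \<and> 0 < e} \<union>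
     {{a \<in> adjointables E. norm (k o\<^sub>L (a - a\<^sub>0)) < e} | a\<^sub>0 k e.
        a\<^sub>0 \<in> adjointables E \<and> k \<in> compacts E \<and> 0 < e})"

definition unital_rep ::
  "('e::complex_banach, 'b, 'y) hilbert_mod_scheme \<Rightarrow> ('f::complex_banach, 'c, 'z) hilbert_mod_scheme
    \<Rightarrow> (('e \<Rightarrow>\<^sub>L 'e) \<Rightarrow> ('f \<Rightarrow>\<^sub>L 'f)) \<Rightarrow> bool"
  where "unital_rep E F \<theta> \<longleftrightarrow>
    (\<forall>a\<in>adjointables E. \<theta> a \<in> adjointables F) \<and>
    (\<forall>a\<in>adjointables E. \<forall>a'\<in>adjointables E. \<theta> (a + a') = \<theta> a + \<theta> a' \<and> \<theta> (a o\<^sub>L a') = \<theta> a o\<^sub>L \<theta> a') \<and>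
    (\<forall>a\<in>adjointables E. \<forall>c. \<theta> (c *\<^sub>C a) = c *\<^sub>C \<theta> a) \<and>
    (\<forall>a\<in>adjointables E. \<theta> (adj E a) = adj F (\<theta> a)) \<and>
    \<theta> id_blinfun = id_blinfun"

definition strict ::
  "('e::complex_banach, 'b, 'y) hilbert_mod_scheme \<Rightarrow> ('f::complex_banach, 'c, 'z) hilbert_mod_scheme
    \<Rightarrow> (('e \<Rightarrow>\<^sub>L 'e) \<Rightarrow> ('f \<Rightarrow>\<^sub>L 'f)) \<Rightarrow> bool"
  where "strict E F \<theta> \<longleftrightarrow> (\<forall>S \<subseteq> adjointables E. bounded S \<longrightarrow>
    continuous_map (subtopology (strict_topology E) S) (strict_topology F) \<theta>)"

definition rep_corr ::
  "('f::complex_banach, 'c) hilbert_mod \<Rightarrow> ('a \<Rightarrow> 'f \<Rightarrow>\<^sub>L 'f) \<Rightarrow> ('f, 'c, 'a) corr"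
  where "rep_corr F \<theta> = \<lparr>ract = ract F, ip = ip F, lact = (\<lambda>a. blinfun_apply (\<theta> a))\<rparr>"

abbreviation op_corr :: "('e::complex_banach, 'b) hilbert_mod \<Rightarrow> ('e, 'b, 'e \<Rightarrow>\<^sub>L 'e) corr"
  where "op_corr E \<equiv> rep_corr E (\<lambda>a. a)"

section \<open>The dual module\<close>

text \<open>\<open>Dual x\<close> is \<open>x\<^sup>*\<close>; scalars act by \<open>c x\<^sup>* = (cnj c x)\<^sup>*\<close>.\<close>

typedef 'e dual = "UNIV :: 'e set" morphisms undual Dual ..

setup_lifting type_definition_dual

instantiation dual :: (complex_banach) real_normed_vector
begin

lift_definition zero_dual :: "'a dual" is "0" .
lift_definition plus_dual :: "'a dual \<Rightarrow> 'a dual \<Rightarrow> 'a dual" is "(+)" .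
lift_definition minus_dual :: "'a dual \<Rightarrow> 'a dual \<Rightarrow> 'a dual" is "(-)" .
lift_definition uminus_dual :: "'a dual \<Rightarrow> 'a dual" is "uminus" .
lift_definition scaleR_dual :: "real \<Rightarrow> 'a dual \<Rightarrow> 'a dual" is "scaleR" .
lift_definition norm_dual :: "'a dual \<Rightarrow> real" is norm .

definition sgn_dual :: "'a dual \<Rightarrow> 'a dual" where "sgn_dual x = inverse (norm x) *\<^sub>R x"
definition dist_dual :: "'a dual \<Rightarrow> 'a dual \<Rightarrow> real" where "dist_dual x y = norm (x - y)"
definition uniformity_dual :: "('a dual \<times> 'a dual) filter"
  where "uniformity_dual = (INF e\<in>{0<..}. principal {(x, y). dist x y < e})"
definition open_dual :: "'a dual set \<Rightarrow> bool"
  where "open_dual S = (\<forall>x\<in>S. \<forall>\<^sub>F (x', y) in uniformity. x' = x \<longrightarrow> y \<in> S)"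

instance
proof
  fix x y z :: "'a dual" and r s :: real
  show "x + y + z = x + (y + z)" by transfer (simp add: add.assoc)
  show "x + y = y + x" by transfer (simp add: add.commute)
  show "0 + x = x" by transfer simp
  show "- x + x = 0" by transfer simp
  show "x - y = x + - y" by transfer simp
  show "r *\<^sub>R (x + y) = r *\<^sub>R x + r *\<^sub>R y" by transfer (simp add: scaleR_add_right)
  show "(r + s) *\<^sub>R x = r *\<^sub>R x + s *\<^sub>R x" by transfer (simp add: scaleR_add_left)
  show "r *\<^sub>R s *\<^sub>R x = (r * s) *\<^sub>R x" by transfer simp
  show "1 *\<^sub>R x = x" by transfer simp
  show "sgn x = inverse (norm x) *\<^sub>R x" by (rule sgn_dual_def)
  show "dist x y = norm (x - y)" by (rule dist_dual_def)
  show "uniformity = (INF e\<in>{0<..}. principal {(x, y :: 'a dual). dist x y < e})"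
    by (rule uniformity_dual_def)
  show "open U = (\<forall>x\<in>U. \<forall>\<^sub>F (x', y) in uniformity. x' = x \<longrightarrow> y \<in> U)" for U :: "'a dual set"
    by (rule open_dual_def)
  show "(norm x = 0) = (x = 0)" by transfer simp
  show "norm (x + y) \<le> norm x + norm y" by transfer (rule norm_triangle_ineq)
  show "norm (r *\<^sub>R x) = \<bar>r\<bar> * norm x" by transfer simp
qed

end

instantiation dual :: (complex_banach) complex_banach
begin

lift_definition scaleC_dual :: "complex \<Rightarrow> 'a dual \<Rightarrow> 'a dual" is "\<lambda>c x. cnj c *\<^sub>C x" .

instance
proof
  fix x y :: "'a dual" and r :: real and c d :: complex
  show "c *\<^sub>C (x + y) = c *\<^sub>C x + c *\<^sub>C y" by transfer (simp add: scaleC_add_right)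
  show "(c + d) *\<^sub>C x = c *\<^sub>C x + d *\<^sub>C x" by transfer (simp add: scaleC_add_left)
  show "c *\<^sub>C d *\<^sub>C x = (c * d) *\<^sub>C x" by transfer (simp add: scaleC_scaleC)
  show "complex_of_real r *\<^sub>C x = r *\<^sub>R x" by transfer (simp add: scaleC_of_real)
  show "norm (c *\<^sub>C x) = cmod c * norm x" by transfer (simp add: norm_scaleC)
next
  fix X :: "nat \<Rightarrow> 'a dual"
  assume "Cauchy X"
  have d: "dist (u :: 'a dual) v = dist (undual u) (undual v)" for u v
    unfolding dist_dual_def dist_norm by transfer simp
  from \<open>Cauchy X\<close> have "Cauchy (\<lambda>n. undual (X n))"
    by (simp add: Cauchy_def d)
  then obtain l where "(\<lambda>n. undual (X n)) \<longlonglongrightarrow> l"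
    using Cauchy_convergent convergent_def by blast
  then have "X \<longlonglongrightarrow> Dual l"
    by (simp add: tendsto_iff d Dual_inverse)
  then show "convergent X"
    by (auto simp: convergent_def)
qed

end

definition dual_corr ::
  "('e::complex_banach, 'b::cstar_algebra) hilbert_mod \<Rightarrow> ('e dual, 'e \<Rightarrow>\<^sub>L 'e, 'b) corr"
  where "dual_corr E = \<lparr>
    ract = (\<lambda>x a. Dual (blinfun_apply (adj E a) (undual x))),
    ip = (\<lambda>x y. rank_one E (undual x) (undual y)),
    lact = (\<lambda>b x. Dual (ract E (undual x) (star b)))\<rparr>"

section \<open>Tensor products\<close>

text \<open>
  \<open>tensor_product A E F T t\<close>: the correspondence \<open>T\<close> from \<open>A\<close> together with \<open>t x y = x \<odot> y\<close> is
  \<open>E \<odot> F\<close>, that is, \<open>T\<close> is generated by the elementary tensors, which have the prescribed inner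
  products and on which \<open>a \<in> A\<close> acts as \<open>a \<odot> id\<close>. The algebra over which the tensor product is
  taken is the one in which the inner product of \<open>E\<close> takes its values and which acts on \<open>F\<close>.
  These conditions determine \<open>(T, t)\<close> up to a unique isomorphism; bilinearity of \<open>t\<close> and
  \<open>x b \<odot> y = x \<odot> b y\<close> follow from them.
\<close>

definition tensor_product ::
  "'a::complex_banach star_alg \<Rightarrow> ('e, 'b, 'a) corr \<Rightarrow> ('f, 'c::cstar_algebra, 'b) corr
    \<Rightarrow> ('t::complex_banach, 'c, 'a) corr \<Rightarrow> ('e \<Rightarrow> 'f \<Rightarrow> 't) \<Rightarrow> bool"
  where "tensor_product A E F T t \<longleftrightarrow>
    correspondence A T \<and>
    (\<forall>x y x' y'. ip T (t x y) (t x' y') = ip F y (lact F (ip E x x') y')) \<and>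
    closed_cspan {t x y | x y. True} = UNIV \<and>
    (\<forall>a\<in>acarrier A. \<forall>x y. lact T a (t x y) = t (lact E a x) y)"

text \<open>
  All maps out of tensor products below are given by their values on a total set of elements:
  \<open>map_given_by G\<close> is the continuous linear map that sends \<open>m\<close> to \<open>n\<close> for all \<open>(m, n) \<in> G\<close>.
\<close>

definition map_given_by :: "('m::complex_banach \<times> 'n::complex_banach) set \<Rightarrow> 'm \<Rightarrow> 'n"
  where "map_given_by G = (THE h. clinear_bounded h \<and> (\<forall>(m, n)\<in>G. h m = n))"

text \<open>The map \<open>g \<odot> h\<close> from \<open>E \<odot> F\<close> to \<open>E' \<odot> F'\<close>, with elementary tensors \<open>t\<close> and \<open>t'\<close>.\<close>

definition tensor_map ::
  "('e \<Rightarrow> 'f \<Rightarrow> 't::complex_banach) \<Rightarrow> ('e' \<Rightarrow> 'f' \<Rightarrow> 't'::complex_banach)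
    \<Rightarrow> ('e \<Rightarrow> 'e') \<Rightarrow> ('f \<Rightarrow> 'f') \<Rightarrow> 't \<Rightarrow> 't'"
  where "tensor_map t t' g h = map_given_by {(t x y, t' (g x) (h y)) | x y. True}"

text \<open>\<open>B \<odot> F = F\<close> via \<open>b \<odot> y \<mapsto> b y\<close>.\<close>

definition unit_ident ::
  "('f::complex_banach, 'c, 'b) corr \<Rightarrow> ('b \<Rightarrow> 'f \<Rightarrow> 's::complex_banach) \<Rightarrow> 's \<Rightarrow> 'f"
  where "unit_ident F s = map_given_by {(s b y, lact F b y) | b y. True}"

text \<open>\<open>E\<^sup>* \<odot> E = B\<close> via \<open>x\<^sup>* \<odot> x' \<mapsto> \<langle>x, x'\<rangle>\<close>.\<close>

definition pairing_ident ::
  "('e, 'b::complex_banach) hilbert_mod \<Rightarrow> ('e dual \<Rightarrow> 'e \<Rightarrow> 'p::complex_banach) \<Rightarrow> 'p \<Rightarrow> 'b"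
  where "pairing_ident E p = map_given_by {(p (Dual x) x', ip E x x') | x x'. True}"

text \<open>
  \<open>(E\<^sup>* \<odot> E) \<odot> F = E\<^sup>* \<odot> (E \<odot> F)\<close>, with elementary tensors \<open>p\<close> of \<open>E\<^sup>* \<odot> E\<close>, \<open>t\<close> of \<open>E \<odot> F\<close>,
  \<open>q\<close> of the left-hand and \<open>r\<close> of the right-hand side.
\<close>

definition assoc_ident ::
  "('x \<Rightarrow> 'e \<Rightarrow> 'p) \<Rightarrow> ('e \<Rightarrow> 'f \<Rightarrow> 't) \<Rightarrow> ('p \<Rightarrow> 'f \<Rightarrow> 'q::complex_banach)
    \<Rightarrow> ('x \<Rightarrow> 't \<Rightarrow> 'r::complex_banach) \<Rightarrow> 'q \<Rightarrow> 'r"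
  where "assoc_ident p t q r = map_given_by {(q (p x x') y, r x (t x' y)) | x x' y. True}"

text \<open>
  \<open>E\<^sup>* \<odot> E \<odot> F = B \<odot> F\<close>, where \<open>E\<^sup>* \<odot> E \<odot> F\<close> is read as \<open>E\<^sup>* \<odot> (E \<odot> F)\<close> and \<open>s\<close> gives the
  elementary tensors of \<open>B \<odot> F\<close>.
\<close>

definition contract ::
  "('e, 'b::complex_banach) hilbert_mod \<Rightarrow> ('e dual \<Rightarrow> 'e \<Rightarrow> 'p::complex_banach) \<Rightarrow> ('e \<Rightarrow> 'f \<Rightarrow> 't)
    \<Rightarrow> ('b \<Rightarrow> 'f \<Rightarrow> 's::complex_banach) \<Rightarrow> ('p \<Rightarrow> 'f \<Rightarrow> 'q::complex_banach)
    \<Rightarrow> ('e dual \<Rightarrow> 't \<Rightarrow> 'r::complex_banach) \<Rightarrow> 'r \<Rightarrow> 's"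
  where "contract E p t s q r = tensor_map q s (pairing_ident E p) id \<circ> inv (assoc_ident p t q r)"

text \<open>The tensor products in the chain for one correspondence \<open>F\<close>, given \<open>P = E\<^sup>* \<odot> E\<close>.\<close>

definition tensor_chain ::
  "('e::complex_banach, 'b::cstar_algebra) hilbert_mod
    \<Rightarrow> ('p::complex_banach, 'b, 'b) corr
    \<Rightarrow> ('f::complex_banach, 'c::cstar_algebra, 'b) corr
    \<Rightarrow> ('t::complex_banach, 'c, 'e \<Rightarrow>\<^sub>L 'e) corr \<Rightarrow> ('e \<Rightarrow> 'f \<Rightarrow> 't)
    \<Rightarrow> ('s::complex_banach, 'c, 'b) corr \<Rightarrow> ('b \<Rightarrow> 'f \<Rightarrow> 's)
    \<Rightarrow> ('q::complex_banach, 'c, 'b) corr \<Rightarrow> ('p \<Rightarrow> 'f \<Rightarrow> 'q)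
    \<Rightarrow> ('r::complex_banach, 'c, 'b) corr \<Rightarrow> ('e dual \<Rightarrow> 't \<Rightarrow> 'r) \<Rightarrow> bool"
  where "tensor_chain E P F T t S s Q q R r \<longleftrightarrow>
    tensor_product (adj_algebra E) (op_corr E) F T t \<and>
    tensor_product whole_algebra self_corr F S s \<and>
    tensor_product whole_algebra P F Q q \<and>
    tensor_product whole_algebra (dual_corr E) T R r"

text \<open>
  The composition \<open>F\<^sub>1 \<rightarrow> B \<odot> F\<^sub>1 \<rightarrow> E\<^sup>* \<odot> E \<odot> F\<^sub>1 \<rightarrow> E\<^sup>* \<odot> E \<odot> F\<^sub>2 \<rightarrow> B \<odot> F\<^sub>2 \<rightarrow> F\<^sub>2\<close> whose middle
  arrow is \<open>id \<odot> u\<close>.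
\<close>

definition induced_map ::
  "('e::complex_banach, 'b::cstar_algebra) hilbert_mod \<Rightarrow> ('e dual \<Rightarrow> 'e \<Rightarrow> 'p::complex_banach)
    \<Rightarrow> ('f1::complex_banach, 'c, 'b) corr \<Rightarrow> ('e \<Rightarrow> 'f1 \<Rightarrow> 't1)
    \<Rightarrow> ('b \<Rightarrow> 'f1 \<Rightarrow> 's1::complex_banach) \<Rightarrow> ('p \<Rightarrow> 'f1 \<Rightarrow> 'q1::complex_banach)
    \<Rightarrow> ('e dual \<Rightarrow> 't1 \<Rightarrow> 'r1::complex_banach)
    \<Rightarrow> ('f2::complex_banach, 'c, 'b) corr \<Rightarrow> ('e \<Rightarrow> 'f2 \<Rightarrow> 't2)
    \<Rightarrow> ('b \<Rightarrow> 'f2 \<Rightarrow> 's2::complex_banach) \<Rightarrow> ('p \<Rightarrow> 'f2 \<Rightarrow> 'q2::complex_banach)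
    \<Rightarrow> ('e dual \<Rightarrow> 't2 \<Rightarrow> 'r2::complex_banach)
    \<Rightarrow> ('t1 \<Rightarrow> 't2) \<Rightarrow> 'f1 \<Rightarrow> 'f2"
  where "induced_map E p F1 t1 s1 q1 r1 F2 t2 s2 q2 r2 u =
    unit_ident F2 s2 \<circ> contract E p t2 s2 q2 r2 \<circ> tensor_map r1 r2 id u \<circ>
    inv (contract E p t1 s1 q1 r1) \<circ> inv (unit_ident F1 s1)"

text \<open>
  \<open>E \<odot> (E\<^sup>* \<odot> F) = F\<close> via \<open>x\<^sub>1 \<odot> x\<^sub>2\<^sup>* \<odot> y \<mapsto> \<theta>(x\<^sub>1 x\<^sub>2\<^sup>*) y\<close>, with elementary tensors \<open>g\<close> of
  \<open>E\<^sup>* \<odot> F\<close> and \<open>t\<close> of \<open>E \<odot> (E\<^sup>* \<odot> F)\<close>.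
\<close>

definition rep_ident ::
  "('e::complex_banach, 'b) hilbert_mod \<Rightarrow> (('e \<Rightarrow>\<^sub>L 'e) \<Rightarrow> 'f \<Rightarrow>\<^sub>L 'f) \<Rightarrow> ('e dual \<Rightarrow> 'f \<Rightarrow> 'g)
    \<Rightarrow> ('e \<Rightarrow> 'g \<Rightarrow> 't::complex_banach) \<Rightarrow> 't \<Rightarrow> 'f::complex_banach"
  where "rep_ident E \<theta> g t =
    map_given_by {(t x1 (g (Dual x2) y), blinfun_apply (\<theta> (rank_one E x1 x2)) y) | x1 x2 y. True}"

end

theory Submission
  imports Defs
begin

text \<open>
  Write \<open>\<kappa>\<^sub>i : E\<^sup>* \<odot> (E \<odot> F\<^sub>i) \<rightarrow> F\<^sub>i\<close> for the canonical identification \<open>x\<^sup>* \<odot> x' \<odot> y \<mapsto> \<langle>x, x'\<rangle> y\<close>, so that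
  the induced map is \<open>v = \<kappa>\<^sub>2 (id \<odot> u) \<kappa>\<^sub>1\<^sup>-\<^sup>1\<close>. The theorem rests on the identity
  \<open>x \<odot> \<kappa>\<^sub>i (z\<^sup>* \<odot> m) = (x z\<^sup>*) m\<close> for all \<open>m\<close> in \<open>E \<odot> F\<^sub>i\<close> (\<open>tensor_contract\<close>): tensoring the contraction
  with \<open>E\<close> gives the action of the rank-one operators. A unitary \<open>u\<close> that intertwines the rank-one
  operators therefore satisfies \<open>x \<odot> v y = u (x \<odot> y)\<close>, first for \<open>y\<close> of the form \<open>\<langle>z, x'\<rangle> y'\<close> and then,
  these being total by fullness of \<open>E\<close> and nondegeneracy of \<open>F\<^sub>1\<close>, for all \<open>y\<close>. Fullness also makes
  \<open>E \<odot> -\<close> faithful: \<open>x \<odot> y = x \<odot> z\<close> for all \<open>x\<close> implies \<open>y = z\<close> (\<open>tensor_cancel\<close>). This yields the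
  uniqueness of \<open>v\<close> and its left linearity (\<open>induced_isomorphism\<close>).

  For the second half, the identification \<open>E \<odot> (E\<^sup>* \<odot> F) = F\<close> is an isomorphism of
  correspondences from \<open>B\<^sup>a(E)\<close>, onto because \<open>F\<close> is isomorphic to \<open>E \<odot> F\<^sub>1\<close> (\<open>rep_ident_corr_iso\<close>).
  So the first half applies to \<open>u'\<close> followed by the inverse of this identification.

  What remains is to see that the identifications exist. A map prescribed on a total set extends to a
  unitary as soon as it preserves inner products and its values are total
  (\<open>map_given_by_unitary\<close>). Comparing inner products is algebra; totality is passed along
  continuous linear maps, so elementary tensors must be continuous in one variable at a time. This amounts to
  automatic continuity of left actions (\<open>norm_lact_le\<close>), since a left action is only
  assumed to be an algebraic *-representation by adjointable maps. The reason for it is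
  that a selfadjoint \<open>h\<close> with \<open>\<parallel>h\<parallel> < 1\<close> is the mean of the two unitaries
  \<open>h \<plusminus> \<i> (1 - h\<^sup>2)\<^sup>1\<^sup>/\<^sup>2\<close> of the unitization, and
  unitaries act isometrically. The square root is the limit of a contracting iteration.
\<close>

section \<open>Complex Banach spaces\<close>

interpretation complex_vector: vector_space "scaleC :: complex \<Rightarrow> 'a \<Rightarrow> 'a::complex_banach"
  by (rule vector_space_scaleC)

lemma scaleR_eq_scaleC: "r *\<^sub>R x = complex_of_real r *\<^sub>C x"
  by (simp add: scaleC_of_real)

lemma closed_cspan_induct [consumes 1, case_names closed zero add scale base]:
  assumes "x \<in> closed_cspan S" and "closed {x. Q x}" and "Q 0"
    and "\<And>x y. Q x \<Longrightarrow> Q y \<Longrightarrow> Q (x + y)" and "\<And>c x. Q x \<Longrightarrow> Q (c *\<^sub>C x)"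
    and "\<And>x. x \<in> S \<Longrightarrow> Q x"
  shows "Q x"
proof -
  have "module.span scaleC S \<subseteq> {x. Q x}"
    using assms(3-6) by (intro complex_vector.span_minimal) (auto simp: complex_vector.subspace_def)
  then have "closed_cspan S \<subseteq> {x. Q x}"
    using assms(2) by (intro closure_minimal)
  then show ?thesis using assms(1) by blast
qed

lemma closed_cspan_base: "x \<in> S \<Longrightarrow> x \<in> closed_cspan S"
  by (meson closure_subset complex_vector.span_base subsetD)

lemma clinear_bounded_continuous: "clinear_bounded h \<Longrightarrow> continuous_on S h"
  by (simp add: clinear_bounded_def linear_continuous_on)

lemma clinear_bounded_add: "clinear_bounded h \<Longrightarrow> h (x + y) = h x + h y"
  by (simp add: clinear_bounded_def linear_simps)

lemma clinear_bounded_scaleC: "clinear_bounded h \<Longrightarrow> h (c *\<^sub>C x) = c *\<^sub>C h x"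
  by (simp add: clinear_bounded_def)

lemma clinear_bounded_zero: "clinear_bounded h \<Longrightarrow> h 0 = 0"
  by (simp add: clinear_bounded_def linear_simps)


lemma clinear_boundedI:
  fixes h :: "'a::complex_banach \<Rightarrow> 'b::complex_banach"
  assumes "\<And>x y. h (x + y) = h x + h y" and "\<And>c x. h (c *\<^sub>C x) = c *\<^sub>C h x"
    and "\<And>x. norm (h x) \<le> norm x * K"
  shows "clinear_bounded h"
  unfolding clinear_bounded_def using assms
  by (auto intro!: bounded_linear_intro[where K = K] simp: scaleR_eq_scaleC)

lemma clinear_bounded_id: "clinear_bounded (\<lambda>x. x)"
  by (simp add: clinear_bounded_def)

lemma bounded_linear_scaleC: "bounded_linear (\<lambda>x::'a::complex_banach. c *\<^sub>C x)"
  by (rule bounded_linear_intro[where K = "cmod c"])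
     (auto simp: scaleC_add_right scaleR_eq_scaleC scaleC_scaleC norm_scaleC mult.commute)

lemma clinear_bounded_compose:
  "clinear_bounded g \<Longrightarrow> clinear_bounded h \<Longrightarrow> clinear_bounded (\<lambda>x. g (h x))"
  by (simp add: clinear_bounded_def bounded_linear_compose)

lemma clinear_bounded_eq_on_total:
  assumes "clinear_bounded g" and "clinear_bounded h" and "closed_cspan S = UNIV"
    and "\<And>x. x \<in> S \<Longrightarrow> g x = h x"
  shows "g x = h x"
proof -
  have "x \<in> closed_cspan S" using assms(3) by simp
  then show ?thesis
  proof (induction rule: closed_cspan_induct)
    case closed
    show ?case by (intro closed_Collect_eq clinear_bounded_continuous assms)
  qed (use assms in \<open>auto simp: clinear_bounded_add clinear_bounded_scaleC clinear_bounded_zero\<close>)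
qed

text \<open>Totality is inherited along continuous linear maps; this replaces all explicit
  approximation of elements by sums of elementary tensors.\<close>

text \<open>Totality is inherited along continuous linear maps. With this lemma and the two corollaries
  below, no element ever has to be approximated explicitly by sums of elementary tensors.\<close>

lemma closed_cspan_image:
  assumes "clinear_bounded h" and "x \<in> closed_cspan S" and "\<And>x. x \<in> S \<Longrightarrow> h x \<in> closed_cspan S'"
  shows "h x \<in> closed_cspan S'"
  using assms(2)
proof (induction rule: closed_cspan_induct)
  case closed
  then show ?case
    using clinear_bounded_continuous[OF assms(1), of UNIV] continuous_closed_preimage[of UNIV h "closed_cspan S'"]
    by (simp add: vimage_def)
next
  case zero
  show ?case
    using clinear_bounded_zero[OF assms(1)] closure_subset complex_vector.span_zero by (metis subsetD)
next
  case (add x y)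
  show ?case
  proof -
    obtain a b where "\<forall>n. a n \<in> module.span scaleC S'" "a \<longlonglongrightarrow> h x"
      "\<forall>n. b n \<in> module.span scaleC S'" "b \<longlonglongrightarrow> h y"
      using add unfolding closure_sequential by blast
    then show ?thesis
      unfolding clinear_bounded_add[OF assms(1)] closure_sequential
      by (intro exI[of _ "\<lambda>n. a n + b n"]) (auto intro: tendsto_add complex_vector.span_add)
  qed
next
  case (scale c x)
  show ?case
  proof -
    obtain a where "\<forall>n. a n \<in> module.span scaleC S'" "a \<longlonglongrightarrow> h x"
      using scale unfolding closure_sequential by blast
    then show ?thesis
      unfolding clinear_bounded_scaleC[OF assms(1)] closure_sequential
      by (intro exI[of _ "\<lambda>n. c *\<^sub>C a n"])
         (auto intro: complex_vector.span_scale bounded_linear.tendsto[OF bounded_linear_scaleC])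
  qed
qed (use assms in auto)

lemma total_trans:
  assumes "closed_cspan S = UNIV" and "\<And>x. x \<in> S \<Longrightarrow> x \<in> closed_cspan S'"
  shows "closed_cspan S' = UNIV"
  using closed_cspan_image[of "\<lambda>x. x" _ S S'] assms clinear_bounded_id by auto

lemma total_image:
  assumes "closed_cspan S = UNIV" and "clinear_bounded h" and "surj h"
    and "\<And>x. x \<in> S \<Longrightarrow> h x \<in> closed_cspan S'"
  shows "closed_cspan S' = UNIV"
  using assms closed_cspan_image[of h _ S S'] by (metis UNIV_I UNIV_eq_I surjD)

section \<open>Bounds in Hilbert modules\<close>

lemma star_zero [simp]: "star (0::'b::cstar_algebra) = 0"
  using star_scaleC[of 0 "0::'b"] by simp


lemma norm_star: "norm (star a) = norm (a::'b::cstar_algebra)"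
proof -
  have le: "norm a \<le> norm (star a)" for a :: 'b
  proof (cases "a = 0")
    case False
    have "norm a * norm a \<le> norm (star a) * norm a"
      using norm_mult_ineq[of "star a" a] by (simp add: cstar_identity power2_eq_square)
    then show ?thesis using False by simp
  qed simp
  from le[of a] le[of "star a"] show ?thesis by (simp add: star_star)
qed

context hilbert_module
begin

lemma norm_power2_ip: "(norm x)\<^sup>2 = norm (ip E x x)"
  by (simp add: norm_ip)

lemma ip_add_left: "ip E (x + y) z = ip E x z + ip E y z"
  by (metis ip_add ip_star star_add)

lemma ip_scaleC_left: "ip E (c *\<^sub>C x) z = cnj c *\<^sub>C ip E x z"
  by (metis ip_scaleC ip_star star_scaleC)

lemma ip_ract_left: "ip E (ract E x b) y = star b * ip E x y"
  by (metis ip_ract ip_star star_mult)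

lemma ip_zero [simp]: "ip E x 0 = 0" "ip E 0 x = 0"
  using ip_scaleC[of x 0 0] ip_scaleC_left[of 0 0 x] by simp_all

lemma ip_diff: "ip E x (y - z) = ip E x y - ip E x z"
  using ip_add[of x "y - z" z] by (simp add: algebra_simps)

lemma ip_diff_left: "ip E (x - y) z = ip E x z - ip E y z"
  using ip_add_left[of "x - y" y z] by (simp add: algebra_simps)

lemma eq_by_ip: "(\<And>z. ip E z x = ip E z y) \<Longrightarrow> x = y"
  using ip_definite[of "x - y"] by (simp add: ip_diff)

text \<open>Polarization turns the triangle inequality of the given norm into a Cauchy-Schwarz
  inequality with constant \<open>4\<close>, and hence into continuity of the inner product.\<close>

lemma norm_ip_le: "norm (ip E x y) \<le> norm x * norm y * 4"
proof -
  have *: "norm (ip E x y) \<le> 4" if "norm x = 1" "norm y = 1" for x y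
  proof -
    \<comment> \<open>Since the inner product is conjugate linear on the left,
      \<open>4 \<langle>x, y\<rangle> = q 1 - q (-1) - \<i> (q \<i> - q (-\<i>))\<close>.\<close>
    let ?q = "\<lambda>c. ip E (x + c *\<^sub>C y) (x + c *\<^sub>C y)"
    have q: "norm (?q c) \<le> 4" if "cmod c = 1" for c
    proof -
      have "norm (x + c *\<^sub>C y) \<le> 2"
        using norm_triangle_ineq[of x "c *\<^sub>C y"] that \<open>norm x = 1\<close> \<open>norm y = 1\<close>
        by (simp add: norm_scaleC)
      then have "(norm (x + c *\<^sub>C y))\<^sup>2 \<le> 2\<^sup>2" by (intro power_mono) auto
      then show ?thesis by (simp add: norm_power2_ip)
    qed
    have "4 *\<^sub>C ip E x y = ((?q 1 - ?q (-1)) - \<i> *\<^sub>C (?q \<i> - ?q (-\<i>)))"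
    proof -
      have "?q 1 - ?q (-1) = 2 *\<^sub>C ip E x y + 2 *\<^sub>C ip E y x"
        unfolding ip_add ip_add_left ip_scaleC ip_scaleC_left
        by (simp add: scaleC_scaleC complex_vector.scale_minus_left)
           (simp add: scaleC_add_left[of 1 1, simplified] algebra_simps)
      moreover have "?q \<i> - ?q (-\<i>) = (2 * \<i>) *\<^sub>C ip E x y - (2 * \<i>) *\<^sub>C ip E y x"
        unfolding ip_add ip_add_left ip_scaleC ip_scaleC_left
        using scaleC_add_left[of \<i> \<i> "ip E x y"] scaleC_add_left[of \<i> \<i> "ip E y x"]
        by (simp add: scaleC_scaleC scaleC_add_right complex_vector.scale_minus_left
            complex_vector.scale_right_diff_distrib)
      moreover have i: "\<i> * (2 * \<i>) = - 2" by (simp add: complex_eq_iff)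
      ultimately show ?thesis
        using scaleC_add_left[of 2 2 "ip E x y"]
        by (simp add: complex_vector.scale_right_diff_distrib scaleC_scaleC i complex_vector.scale_minus_left)
    qed
    then have "norm (4 *\<^sub>C ip E x y) \<le> norm (?q 1 - ?q (-1)) + norm (\<i> *\<^sub>C (?q \<i> - ?q (-\<i>)))"
      by (metis norm_triangle_ineq4)
    also have "\<dots> \<le> (norm (?q 1) + norm (?q (-1))) + (norm (?q \<i>) + norm (?q (-\<i>)))"
      unfolding norm_scaleC by (simp add: add_mono norm_triangle_ineq4)
    also have "\<dots> \<le> (4 + 4) + (4 + 4)"
      by (intro add_mono q) auto
    finally show ?thesis by (simp add: norm_scaleC)
  qed
  show ?thesis
  proof (cases "x = 0 \<or> y = 0")
    case False
    define x' y' where "x' = (1 / norm x) *\<^sub>R x" and "y' = (1 / norm y) *\<^sub>R y"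
    have "norm (ip E x' y') \<le> 4" using * False by (simp add: x'_def y'_def)
    moreover have "norm (ip E x' y') = norm (ip E x y) / (norm x * norm y)"
      unfolding x'_def y'_def scaleR_eq_scaleC ip_scaleC ip_scaleC_left norm_scaleC
      by (simp add: norm_divide)
    ultimately show ?thesis using False by (simp add: field_simps)
  qed auto
qed

lemma bounded_bilinear_ip: "bounded_bilinear (ip E)"
  by unfold_locales
     (auto simp: ip_add ip_add_left ip_scaleC ip_scaleC_left scaleR_eq_scaleC
       intro!: exI[of _ 4] norm_ip_le)

lemma norm_ract_le: "norm (ract E x b) \<le> norm x * norm b"
proof (rule power2_le_imp_le)
  have "(norm (ract E x b))\<^sup>2 = norm (star b * ip E x x * b)"
    by (simp add: norm_power2_ip ip_ract ip_ract_left)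
  also have "\<dots> \<le> norm (star b) * norm (ip E x x) * norm b"
    by (meson mult_right_mono norm_ge_zero norm_mult_ineq order_trans)
  also have "\<dots> = (norm x * norm b)\<^sup>2"
    by (simp add: norm_star power_mult_distrib norm_power2_ip[symmetric] power2_eq_square ac_simps)
  finally show "(norm (ract E x b))\<^sup>2 \<le> (norm x * norm b)\<^sup>2" .
qed simp

lemma clinear_bounded_ip: "clinear_bounded (ip E x)"
  by (rule clinear_boundedI[where K = "norm x * 4"])
     (auto simp: ip_add ip_scaleC norm_ip_le ac_simps, metis norm_ip_le mult.assoc mult.commute)

text \<open>Identities in a tensor product are proved by testing against elementary tensors.\<close>

lemma eq_by_ip_total:
  assumes "closed_cspan S = UNIV" and "\<And>z. z \<in> S \<Longrightarrow> ip E z x = ip E z y"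
  shows "x = y"
proof -
  have "ip E (x - y) z = 0" for z
  proof -
    have "ip E (x - y) z = (\<lambda>_. 0) z"
    proof (rule clinear_bounded_eq_on_total[OF _ _ assms(1)])
      show "clinear_bounded (ip E (x - y))" by (rule clinear_bounded_ip)
      show "clinear_bounded (\<lambda>_::'e. 0::'b)" by (rule clinear_boundedI[where K = 0]) auto
      show "ip E (x - y) z = 0" if "z \<in> S" for z
        using assms(2)[OF that] ip_star[of z "x - y"] by (simp add: ip_diff)
    qed
    then show ?thesis by simp
  qed
  then show ?thesis using ip_definite[of "x - y"] by simp
qed

lemma clinear_rank_one: "clinear_bounded (\<lambda>z. ract E x (ip E y z))"
proof (rule clinear_boundedI[where K = "norm x * norm y * 4"])
  fix z
  have "norm (ract E x (ip E y z)) \<le> norm x * norm (ip E y z)" by (rule norm_ract_le)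
  also have "\<dots> \<le> norm x * (norm y * norm z * 4)" by (intro mult_left_mono norm_ip_le) auto
  finally show "norm (ract E x (ip E y z)) \<le> norm z * (norm x * norm y * 4)" by (simp add: ac_simps)
qed (simp_all add: ip_add ip_scaleC ract_add_right ract_scaleC_right)

lemma rank_one_apply: "blinfun_apply (rank_one E x y) z = ract E x (ip E y z)"
  using clinear_rank_one[of x y]
  by (simp add: rank_one_def clinear_bounded_def bounded_linear_Blinfun_apply)

lemma adj_eqI: "(\<And>x y. ip E (blinfun_apply a x) y = ip E x (blinfun_apply a' y)) \<Longrightarrow> adj E a = a'"
  unfolding adj_def by (rule the_equality) (auto intro!: blinfun_eqI eq_by_ip)

lemma adj: "a \<in> adjointables E \<Longrightarrow> ip E (blinfun_apply a x) y = ip E x (blinfun_apply (adj E a) y)"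
  using adj_eqI[of a] unfolding adjointables_def by auto

lemma adj_right: "a \<in> adjointables E \<Longrightarrow> ip E x (blinfun_apply a y) = ip E (blinfun_apply (adj E a) x) y"
  by (metis adj ip_star)

lemma adjointablesI:
  "(\<And>x y. ip E (blinfun_apply a x) y = ip E x (blinfun_apply a' y)) \<Longrightarrow> a \<in> adjointables E"
  by (auto simp: adjointables_def)

lemma adjointable_scaleC: "a \<in> adjointables E \<Longrightarrow> blinfun_apply a (c *\<^sub>C x) = c *\<^sub>C blinfun_apply a x"
  by (rule eq_by_ip) (simp add: adj_right ip_scaleC)

lemma adj_adjointable: "a \<in> adjointables E \<Longrightarrow> adj E a \<in> adjointables E"
  by (rule adjointablesI[of _ a]) (simp add: adj_right)

lemma adj_adj: "a \<in> adjointables E \<Longrightarrow> adj E (adj E a) = a"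
  by (rule adj_eqI) (simp add: adj_right)

lemma rank_one_ip: "ip E (blinfun_apply (rank_one E x y) z) w = ip E z (blinfun_apply (rank_one E y x) w)"
  by (simp add: rank_one_apply ip_ract ip_ract_left ip_star)

lemma rank_one_adjointable: "rank_one E x y \<in> adjointables E"
  by (rule adjointablesI rank_one_ip)+

lemma adj_rank_one: "adj E (rank_one E x y) = rank_one E y x"
  by (rule adj_eqI) (rule rank_one_ip)

lemma adjointables_add: "a \<in> adjointables E \<Longrightarrow> b \<in> adjointables E \<Longrightarrow> a + b \<in> adjointables E"
  by (rule adjointablesI[of _ "adj E a + adj E b"]) (simp add: adj blinfun.add_left ip_add ip_add_left)

lemma adj_add: "a \<in> adjointables E \<Longrightarrow> b \<in> adjointables E \<Longrightarrow> adj E (a + b) = adj E a + adj E b"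
  by (rule adj_eqI) (simp add: adj blinfun.add_left ip_add ip_add_left)

lemma scaleC_ip: "a \<in> adjointables E \<Longrightarrow>
    ip E (blinfun_apply (c *\<^sub>C a) x) y = ip E x (blinfun_apply (cnj c *\<^sub>C adj E a) y)"
  by (simp add: adj scaleC_blinfun.rep_eq ip_scaleC ip_scaleC_left)

lemma adjointables_scaleC: "a \<in> adjointables E \<Longrightarrow> c *\<^sub>C a \<in> adjointables E"
  by (rule adjointablesI) (rule scaleC_ip)

lemma adj_scaleC: "a \<in> adjointables E \<Longrightarrow> adj E (c *\<^sub>C a) = cnj c *\<^sub>C adj E a"
  by (rule adj_eqI) (rule scaleC_ip)

lemma adjointables_compose: "a \<in> adjointables E \<Longrightarrow> b \<in> adjointables E \<Longrightarrow> a o\<^sub>L b \<in> adjointables E"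
  by (rule adjointablesI[of _ "adj E b o\<^sub>L adj E a"]) (simp add: adj)

lemma adj_compose: "a \<in> adjointables E \<Longrightarrow> b \<in> adjointables E \<Longrightarrow> adj E (a o\<^sub>L b) = adj E b o\<^sub>L adj E a"
  by (rule adj_eqI) (simp add: adj)

lemma norm_adj_le: "a \<in> adjointables E \<Longrightarrow> norm (adj E a) \<le> 4 * norm a"
proof (rule norm_blinfun_bound)
  fix y
  assume a: "a \<in> adjointables E"
  let ?z = "blinfun_apply (adj E a) y"
  have "norm ?z * norm ?z = norm (ip E (blinfun_apply a ?z) y)"
    by (simp add: adj[OF a] norm_power2_ip[symmetric] power2_eq_square)
  also have "\<dots> \<le> norm (blinfun_apply a ?z) * norm y * 4" by (rule norm_ip_le)
  also have "\<dots> \<le> (norm a * norm ?z) * norm y * 4" by (intro mult_right_mono norm_blinfun) auto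
  finally have "norm ?z * norm ?z \<le> (4 * norm a * norm y) * norm ?z" by (simp add: ac_simps)
  then show "norm ?z \<le> 4 * norm a * norm y"
    by (cases "?z = 0") auto
qed simp

lemma adjointables_diff: "a \<in> adjointables E \<Longrightarrow> b \<in> adjointables E \<Longrightarrow> a - b \<in> adjointables E"
  by (rule adjointablesI[of _ "adj E a - adj E b"]) (simp add: adj blinfun.diff_left ip_diff ip_diff_left)

lemma adj_diff: "a \<in> adjointables E \<Longrightarrow> b \<in> adjointables E \<Longrightarrow> adj E (a - b) = adj E a - adj E b"
  by (rule adj_eqI) (simp add: adj blinfun.diff_left ip_diff ip_diff_left)

text \<open>By boundedness of the involution the adjoints of a convergent sequence form a Cauchy sequence, and their limit is
  the adjoint of the limit.\<close>

lemma closed_adjointables: "closed (adjointables E)"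
  unfolding closed_sequential_limits
proof (intro allI impI, elim conjE)
  fix a l assume a: "\<forall>n. a n \<in> adjointables E" and l: "a \<longlonglongrightarrow> l"
  have "Cauchy (\<lambda>n. adj E (a n))"
  proof (rule metric_CauchyI)
    fix e :: real assume "0 < e"
    then obtain M where M: "\<And>m n. m \<ge> M \<Longrightarrow> n \<ge> M \<Longrightarrow> dist (a m) (a n) < e / 4"
      using LIMSEQ_imp_Cauchy[OF l] unfolding Cauchy_def by (metis zero_less_divide_iff zero_less_numeral)
    have "dist (adj E (a m)) (adj E (a n)) < e" if "m \<ge> M" "n \<ge> M" for m n
    proof -
      have "norm (adj E (a m - a n)) \<le> 4 * norm (a m - a n)"
        using a by (intro norm_adj_le adjointables_diff) auto
      then show ?thesis using M[OF that] a by (simp add: dist_norm adj_diff)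
    qed
    then show "\<exists>M. \<forall>m\<ge>M. \<forall>n\<ge>M. dist (adj E (a m)) (adj E (a n)) < e" by blast
  qed
  then obtain l' where l': "(\<lambda>n. adj E (a n)) \<longlonglongrightarrow> l'"
    using Cauchy_convergent convergent_def by blast
  show "l \<in> adjointables E"
  proof (rule adjointablesI)
    fix x y
    have "(\<lambda>n. ip E (blinfun_apply (a n) x) y) \<longlonglongrightarrow> ip E (blinfun_apply l x) y"
      by (intro bounded_bilinear.tendsto[OF bounded_bilinear_ip] blinfun.tendsto l tendsto_const)
    moreover have "(\<lambda>n. ip E (blinfun_apply (a n) x) y) \<longlonglongrightarrow> ip E x (blinfun_apply l' y)"
      using a by (simp add: adj)
        (intro bounded_bilinear.tendsto[OF bounded_bilinear_ip] blinfun.tendsto l' tendsto_const)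
    ultimately show "ip E (blinfun_apply l x) y = ip E x (blinfun_apply l' y)"
      by (rule LIMSEQ_unique)
  qed
qed

end

section \<open>Continuity of left actions\<close>

text \<open>The common setting for the two kinds of algebras that act from the left: a C*-algebra, and
  \<open>B\<^sup>a(E)\<close> inside the bounded operators on \<open>E\<close>. The product is that of the ambient type, whereas
  the involution makes sense on the carrier only. The involution is merely bounded because on
  \<open>B\<^sup>a(E)\<close> it comes from a Cauchy-Schwarz inequality with a constant.\<close>

locale banach_star_algebra =
  fixes A :: "'a::complex_banach star_alg" and K :: real
  assumes bounded_bilinear_amult: "bounded_bilinear (amult A)"
    and norm_amult: "norm (amult A a b) \<le> norm a * norm b"
    and amult_assoc: "amult A (amult A a b) c = amult A a (amult A b c)"
    and amult_scaleC_left: "amult A (z *\<^sub>C a) b = z *\<^sub>C amult A a b"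
    and amult_scaleC_right: "a \<in> acarrier A \<Longrightarrow> amult A a (z *\<^sub>C b) = z *\<^sub>C amult A a b"
    and closed_acarrier: "closed (acarrier A)"
    and zero_in: "0 \<in> acarrier A"
    and add_in: "a \<in> acarrier A \<Longrightarrow> b \<in> acarrier A \<Longrightarrow> a + b \<in> acarrier A"
    and scaleC_in: "a \<in> acarrier A \<Longrightarrow> z *\<^sub>C a \<in> acarrier A"
    and amult_in: "a \<in> acarrier A \<Longrightarrow> b \<in> acarrier A \<Longrightarrow> amult A a b \<in> acarrier A"
    and astar_in: "a \<in> acarrier A \<Longrightarrow> astar A a \<in> acarrier A"
    and astar_add: "a \<in> acarrier A \<Longrightarrow> b \<in> acarrier A \<Longrightarrow> astar A (a + b) = astar A a + astar A b"
    and astar_scaleC: "a \<in> acarrier A \<Longrightarrow> astar A (z *\<^sub>C a) = cnj z *\<^sub>C astar A a"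
    and astar_amult: "a \<in> acarrier A \<Longrightarrow> b \<in> acarrier A \<Longrightarrow> astar A (amult A a b) = amult A (astar A b) (astar A a)"
    and astar_astar: "a \<in> acarrier A \<Longrightarrow> astar A (astar A a) = a"
    and norm_astar: "a \<in> acarrier A \<Longrightarrow> norm (astar A a) \<le> K * norm a"
begin


lemma diff_in: "a \<in> acarrier A \<Longrightarrow> b \<in> acarrier A \<Longrightarrow> a - b \<in> acarrier A"
  using add_in[of a "(-1) *\<^sub>C b"] scaleC_in[of b "-1"] by (simp add: complex_vector.scale_minus_left)

lemma astar_diff: "a \<in> acarrier A \<Longrightarrow> b \<in> acarrier A \<Longrightarrow> astar A (a - b) = astar A a - astar A b"
  using astar_add[of a "(-1) *\<^sub>C b"] scaleC_in[of b "-1"] astar_scaleC[of b "-1"]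
  by (simp add: complex_vector.scale_minus_left)

lemma closed_selfadjoint: "closed {d \<in> acarrier A. astar A d = d}"
  unfolding closed_sequential_limits
proof (intro allI impI, elim conjE)
  fix a l assume a: "\<forall>n. a n \<in> {d \<in> acarrier A. astar A d = d}" and l: "a \<longlonglongrightarrow> l"
  have lin: "l \<in> acarrier A"
    using closed_acarrier a l unfolding closed_sequential_limits by blast
  have "\<forall>\<^sub>F n in sequentially. norm (a n - astar A l) \<le> K * norm (a n - l)"
  proof (rule always_eventually, rule allI)
    fix n
    have "a n \<in> acarrier A" "astar A (a n) = a n" using a by auto
    then show "norm (a n - astar A l) \<le> K * norm (a n - l)"
      using norm_astar[of "a n - l"] lin by (simp add: diff_in astar_diff)
  qed
  moreover have "(\<lambda>n. K * norm (a n - l)) \<longlonglongrightarrow> 0"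
    using tendsto_mult[OF tendsto_const[of K] tendsto_norm[OF LIM_zero[OF l]]] by simp
  ultimately have "(\<lambda>n. a n - astar A l) \<longlonglongrightarrow> 0"
    by (rule Lim_null_comparison)
  then have "a \<longlonglongrightarrow> astar A l"
    by (rule LIM_zero_cancel)
  then show "l \<in> {d \<in> acarrier A. astar A d = d}"
    using LIMSEQ_unique l lin by auto
qed

text \<open>The element \<open>d\<close> is \<open>1 - (1 - h\<^sup>2)\<^sup>1\<^sup>/\<^sup>2\<close>, which exists without a unit because it is the fixed
  point of \<open>d \<mapsto> (h\<^sup>2 + d\<^sup>2) / 2\<close>.\<close>

lemma sqrt_defect:
  assumes h: "h \<in> acarrier A" "astar A h = h" and small: "norm h < 1"
  obtains d where "d \<in> acarrier A" "astar A d = d" "amult A d h = amult A h d"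
    "d + d = amult A h h + amult A d d"
proof -
  interpret amult: bounded_bilinear "amult A" by (rule bounded_bilinear_amult)
  define a where "a = (norm h)\<^sup>2"
  define \<rho> where "\<rho> = 1 - sqrt (1 - a)"
  have a: "0 \<le> a" "a < 1" using small by (auto simp: a_def abs_square_less_1)
  have \<rho>: "0 \<le> \<rho>" "\<rho> < 1" "a + \<rho>\<^sup>2 = 2 * \<rho>" using a by (auto simp: \<rho>_def power2_diff)
  define f where "f d = (1/2) *\<^sub>C (amult A h h + amult A d d)" for d
  \<comment> \<open>The iteration maps this ball into itself because \<open>a + \<rho>\<^sup>2 = 2 \<rho>\<close>, and it contracts the ball by
    the factor \<open>\<rho>\<close>. The other two conditions are closed and invariant, so the fixed point inherits
    them.\<close>
  define S where "S = cball 0 \<rho> \<inter> {d \<in> acarrier A. astar A d = d} \<inter> {d. amult A d h = amult A h d}"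
  have "\<exists>!d. d \<in> S \<and> f d = d"
  proof (rule Banach_fix[where c = \<rho>])
    have "closed {d. amult A d h = amult A h d}"
      by (intro closed_Collect_eq linear_continuous_on amult.bounded_linear_left amult.bounded_linear_right)
    then show "complete S"
      unfolding S_def complete_eq_closed by (intro closed_Int closed_selfadjoint closed_cball)
    have "astar A 0 = 0" using astar_scaleC[OF zero_in, of 0] by simp
    then have "0 \<in> S" using \<rho> zero_in by (simp add: S_def amult.zero_left amult.zero_right)
    then show "S \<noteq> {}" by blast
    show "0 \<le> \<rho>" "\<rho> < 1" by (fact \<rho>)+
    show "f ` S \<subseteq> S"
    proof safe
      fix d assume "d \<in> S"
      then have d: "norm d \<le> \<rho>" "d \<in> acarrier A" "astar A d = d" "amult A d h = amult A h d"
        by (auto simp: S_def)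
      have "norm (f d) \<le> (1/2) * (norm (amult A h h) + norm (amult A d d))"
        unfolding f_def norm_scaleC by (simp add: norm_triangle_ineq)
      also have "\<dots> \<le> (1/2) * (norm h * norm h + norm d * norm d)"
        by (intro mult_left_mono add_mono norm_amult) auto
      also have "\<dots> \<le> (1/2) * (a + \<rho> * \<rho>)"
        using d(1) by (intro mult_left_mono add_mono mult_mono) (auto simp: a_def power2_eq_square \<rho>)
      also have "\<dots> = \<rho>" using \<rho>(3) by (simp add: power2_eq_square)
      finally have "norm (f d) \<le> \<rho>" .
      moreover have "f d \<in> acarrier A" "astar A (f d) = f d"
        using d h by (auto simp: f_def scaleC_in add_in amult_in astar_scaleC astar_add astar_amult)
      moreover have "amult A (amult A d d) h = amult A h (amult A d d)"
        by (metis amult_assoc d(4))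
      then have "amult A (f d) h = amult A h (f d)"
        by (simp add: f_def amult_scaleC_left amult_scaleC_right[OF h(1)] amult.add_left amult.add_right amult_assoc)
      ultimately show "f d \<in> S" by (auto simp: S_def)
    qed
    show "dist (f x) (f y) \<le> \<rho> * dist x y" if "x \<in> S" "y \<in> S" for x y
    proof -
      have n: "norm x \<le> \<rho>" "norm y \<le> \<rho>" using that by (auto simp: S_def)
      have "f x - f y = (1/2) *\<^sub>C (amult A x (x - y) + amult A (x - y) y)"
        by (simp add: f_def complex_vector.scale_right_diff_distrib[symmetric] amult.diff_left amult.diff_right)
      then have "dist (f x) (f y) = (1/2) * norm (amult A x (x - y) + amult A (x - y) y)"
        by (simp add: dist_norm norm_scaleC)
      also have "\<dots> \<le> (1/2) * (norm x * norm (x - y) + norm (x - y) * norm y)"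
        by (intro mult_left_mono norm_triangle_le add_mono norm_amult) auto
      also have "\<dots> \<le> (1/2) * (\<rho> * norm (x - y) + norm (x - y) * \<rho>)"
        using n \<rho> by (intro mult_left_mono add_mono mult_mono) auto
      finally show ?thesis by (simp add: dist_norm)
    qed
  qed
  then obtain d where "d \<in> S" "f d = d" by blast
  moreover have "2 *\<^sub>C f d = amult A h h + amult A d d"
    by (simp add: f_def scaleC_scaleC)
  moreover have "2 *\<^sub>C d = d + d" using scaleC_add_left[of 1 1 d] by simp
  ultimately show ?thesis by (intro that[of d]) (auto simp: S_def)
qed

end

lemma banach_star_algebra_whole: "banach_star_algebra (whole_algebra :: 'b::cstar_algebra star_alg) 1"
  by (rule banach_star_algebra.intro)
     (auto simp: whole_algebra_def bounded_bilinear_mult norm_mult_ineq mult.assoc mult_scaleC_left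
       mult_scaleC_right star_add star_scaleC star_mult star_star norm_star)

lemma banach_star_algebra_adj:
  assumes "hilbert_module E"
  shows "banach_star_algebra (adj_algebra E) 4"
proof -
  interpret hilbert_module E by fact
  show ?thesis
  proof (rule banach_star_algebra.intro, unfold adj_algebra_def star_alg.simps)
    show "0 \<in> adjointables E" by (rule adjointablesI[of _ 0]) simp
  qed (auto simp: bounded_bilinear_blinfun_compose norm_blinfun_compose closed_adjointables
      adjointables_add adjointables_scaleC adjointables_compose adj_adjointable adj_add adj_scaleC
      adj_compose adj_adj norm_adj_le scaleC_blinfun.rep_eq adjointable_scaleC
      intro!: blinfun_eqI)
qed

context correspondence
begin

lemma lact_add_right: "banach_star_algebra A K \<Longrightarrow> a \<in> acarrier A \<Longrightarrow> lact F a (y + z) = lact F a y + lact F a z"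
  by (rule eq_by_ip)
     (metis banach_star_algebra.astar_astar banach_star_algebra.astar_in ip_add lact_star)

lemma lact_scaleC_right: "banach_star_algebra A K \<Longrightarrow> a \<in> acarrier A \<Longrightarrow> lact F a (c *\<^sub>C y) = c *\<^sub>C lact F a y"
  by (rule eq_by_ip)
     (metis banach_star_algebra.astar_astar banach_star_algebra.astar_in ip_scaleC lact_star)

text \<open>The next three lemmas give the automatic continuity of left actions. A selfadjoint \<open>h\<close> of norm less than \<open>1\<close> is the mean of the unitaries
  \<open>h \<plusminus> \<i> (1 - h\<^sup>2)\<^sup>1\<^sup>/\<^sup>2\<close> of the unitization. These act isometrically, whatever is known about the
  continuity of the action, so \<open>h\<close> acts contractively by the triangle inequality.\<close>

lemma lact_selfadjoint_contractive:
  assumes A: "banach_star_algebra A K" and h: "h \<in> acarrier A" "astar A h = h" "norm h < 1"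
  shows "norm (lact F h y) \<le> norm y"
proof -
  interpret A: banach_star_algebra A K by (rule A)
  obtain d where d: "d \<in> acarrier A" "astar A d = d" "amult A d h = amult A h d"
    "d + d = amult A h h + amult A d d"
    using A.sqrt_defect h by blast
  define k where "k = y - lact F d y"
  have hd: "lact F h (lact F d y) = lact F d (lact F h y)"
    using lact_mult[OF h(1) d(1)] lact_mult[OF d(1) h(1)] d(3) by metis
  have dd: "lact F d y + lact F d y = lact F h (lact F h y) + lact F d (lact F d y)"
    using lact_add[OF d(1) d(1)] d(4) lact_add[OF A.amult_in[OF h(1) h(1)] A.amult_in[OF d(1) d(1)]]
      lact_mult h(1) d(1) by metis
  \<comment> \<open>Here \<open>k\<close> is \<open>(1 - h\<^sup>2)\<^sup>1\<^sup>/\<^sup>2 y\<close>, and \<open>c\<close> stands for \<open>\<i>\<close> or \<open>-\<i>\<close>.\<close>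
  have iso: "norm (lact F h y + c *\<^sub>C k) = norm y" if c: "cnj c * c = 1" "cnj c = - c" for c
  proof -
    have hh: "ip F (lact F h z) w = ip F z (lact F h w)" for z w using lact_star[OF h(1)] h(2) by simp
    have dds: "ip F (lact F d z) w = ip F z (lact F d w)" for z w using lact_star[OF d(1)] d(2) by simp
    have "ip F (lact F h y) k = ip F k (lact F h y)"
      by (simp add: k_def ip_diff ip_diff_left hh dds hd)
    moreover have "ip F (lact F h y) (lact F h y) + ip F k k = ip F y y"
    proof -
      have "ip F y (lact F d y) + ip F y (lact F d y) =
          ip F (lact F h y) (lact F h y) + ip F (lact F d y) (lact F d y)"
        using dd by (metis hh dds ip_add)
      then show ?thesis by (simp add: k_def ip_diff ip_diff_left dds algebra_simps)
    qed
    moreover have *: "c *\<^sub>C c *\<^sub>C z = - z" for z :: 'c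
    proof -
      have "c * c = - 1" using c by (metis minus_equation_iff mult_minus_left)
      then show ?thesis by (simp add: scaleC_scaleC complex_vector.scale_minus_left)
    qed
    ultimately have "ip F (lact F h y + c *\<^sub>C k) (lact F h y + c *\<^sub>C k) = ip F y y"
      using c by (simp add: ip_add ip_add_left ip_scaleC ip_scaleC_left
          complex_vector.scale_minus_left complex_vector.scale_right_diff_distrib *)
    then show ?thesis by (simp add: norm_ip)
  qed
  have "lact F h y + lact F h y = (lact F h y + \<i> *\<^sub>C k) + (lact F h y + (-\<i>) *\<^sub>C k)"
    by (simp add: complex_vector.scale_minus_left)
  then have "norm (2 *\<^sub>R lact F h y) \<le> norm (lact F h y + \<i> *\<^sub>C k) + norm (lact F h y + (-\<i>) *\<^sub>C k)"
    unfolding scaleR_2 by (metis norm_triangle_ineq)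
  also have "\<dots> = norm y + norm y" by (subst (1 2) iso) auto
  finally show ?thesis by simp
qed

lemma norm_lact_selfadjoint:
  assumes A: "banach_star_algebra A K" and h: "h \<in> acarrier A" "astar A h = h"
  shows "norm (lact F h y) \<le> norm h * norm y"
proof -
  interpret A: banach_star_algebra A K by (rule A)
  have "norm (lact F h y) \<le> r * norm y" if r: "r > norm h" for r
  proof -
    have r0: "r > 0" using r norm_ge_zero[of h] by linarith
    define g where "g = complex_of_real (1/r) *\<^sub>C h"
    have "norm (lact F g y) \<le> norm y"
      using h r r0 by (intro lact_selfadjoint_contractive[OF A])
        (auto simp: g_def A.scaleC_in A.astar_scaleC norm_scaleC norm_divide)
    moreover have "norm (lact F g y) = norm (lact F h y) / r"
      unfolding g_def lact_scaleC[OF h(1)] norm_scaleC using r0 by (simp add: norm_divide)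
    ultimately show ?thesis using r0 by (simp add: field_simps)
  qed
  \<comment> \<open>Let \<open>r\<close> decrease to the norm of \<open>h\<close>.\<close>
  then show ?thesis
    by (intro tendsto_lowerbound[of "\<lambda>r. r * norm y" "norm h * norm y" "at_right (norm h)"])
       (auto intro!: tendsto_intros simp: eventually_at_right_less eventually_mono[OF eventually_at_right_less])
qed

lemma norm_lact_le:
  assumes A: "banach_star_algebra A K" and a: "a \<in> acarrier A"
  shows "norm (lact F a y) \<le> (1 + K) * norm a * norm y"
proof -
  interpret A: banach_star_algebra A K by (rule A)
  \<comment> \<open>The decomposition \<open>a = g - \<i> h\<close> into selfadjoint elements.\<close>
  define g where "g = (1/2) *\<^sub>C (a + astar A a)"
  define h where "h = (\<i>/2) *\<^sub>C (a - astar A a)"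
  have in': "astar A a \<in> acarrier A" "a + astar A a \<in> acarrier A" "a - astar A a \<in> acarrier A"
    using a by (auto simp: A.astar_in A.add_in A.diff_in)
  have g: "g \<in> acarrier A" "astar A g = g"
    using a in' by (auto simp: g_def A.scaleC_in A.astar_scaleC A.astar_add A.astar_astar add.commute)
  have h: "h \<in> acarrier A" "astar A h = h"
    using a in' by (auto simp: h_def A.scaleC_in A.astar_scaleC A.astar_diff A.astar_astar
        complex_vector.scale_minus_left simp flip: complex_vector.scale_minus_right
        simp del: complex_vector.scale_right_diff_distrib)
  have ng: "norm g \<le> (1 + K) / 2 * norm a"
    using A.norm_astar[OF a] norm_triangle_ineq[of a "astar A a"]
    unfolding g_def norm_scaleC by (simp add: field_simps)
  have nh: "norm h \<le> (1 + K) / 2 * norm a"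
    using A.norm_astar[OF a] norm_triangle_ineq4[of a "astar A a"]
    unfolding h_def norm_scaleC by (simp add: norm_divide field_simps)
  have "a = g + (-\<i>) *\<^sub>C h"
    using scaleC_add_left[of "1/2" "1/2" a]
    by (simp add: g_def h_def scaleC_scaleC scaleC_add_right complex_vector.scale_right_diff_distrib)
  then have "lact F a y = lact F g y + (-\<i>) *\<^sub>C lact F h y"
    using lact_add[OF g(1) A.scaleC_in[OF h(1)]] lact_scaleC[OF h(1)] by metis
  then have "norm (lact F a y) \<le> norm (lact F g y) + norm (lact F h y)"
    using norm_triangle_ineq[of "lact F g y" "(-\<i>) *\<^sub>C lact F h y"] by (simp add: norm_scaleC)
  also have "\<dots> \<le> norm g * norm y + norm h * norm y"
    by (intro add_mono norm_lact_selfadjoint[OF A] g h)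
  also have "\<dots> \<le> ((1 + K) / 2 * norm a) * norm y + ((1 + K) / 2 * norm a) * norm y"
    by (intro add_mono mult_right_mono ng nh) auto
  finally show ?thesis by (simp add: field_simps)
qed

lemma clinear_bounded_lact:
  assumes "banach_star_algebra A K" "a \<in> acarrier A"
  shows "clinear_bounded (lact F a)"
  using norm_lact_le[OF assms]
  by (intro clinear_boundedI[where K = "(1 + K) * norm a"])
     (auto simp: lact_add_right[OF assms] lact_scaleC_right[OF assms] mult.commute)

end

section \<open>Unitaries given on a total set\<close>

context hilbert_module
begin

lemma eq_by_ip_self: "ip E x x = ip E x y \<Longrightarrow> ip E y x = ip E y y \<Longrightarrow> x = y"
  using ip_definite[of "x - y"] by (simp add: ip_diff ip_diff_left)

end

lemma ip_preserving_norm: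
  assumes "hilbert_module M" and "hilbert_module N" and "ip N (h x) (h x) = ip M x x"
  shows "norm (h x) = norm x"
  using assms by (simp add: hilbert_module.norm_ip)

text \<open>Expanding \<open>\<langle>d, d\<rangle>\<close> for \<open>d = h (x + y) - h x - h y\<close> leaves only inner products of values of \<open>h\<close>, so it
  has the value that it would have for the identity map, which is \<open>0\<close>.\<close>

lemma ip_preserving_clinear_bounded:
  assumes M: "hilbert_module M" and N: "hilbert_module N"
    and ip: "\<And>x y. ip N (h x) (h y) = ip M x y"
  shows "clinear_bounded h"
proof (rule clinear_boundedI[where K = 1])
  interpret M: hilbert_module M by fact
  interpret N: hilbert_module N by fact
  show "h (x + y) = h x + h y" for x y
    by (rule N.eq_by_ip_self) (simp_all add: N.ip_add N.ip_add_left ip M.ip_add M.ip_add_left)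
  show "h (c *\<^sub>C x) = c *\<^sub>C h x" for c x
    by (rule N.eq_by_ip_self)
       (simp_all add: N.ip_scaleC N.ip_scaleC_left ip M.ip_scaleC M.ip_scaleC_left)
  show "norm (h x) \<le> norm x * 1" for x
    using ip_preserving_norm[OF M N, of h x] ip by simp
qed

lemma unitary_clinear_bounded:
  "hilbert_module M \<Longrightarrow> hilbert_module N \<Longrightarrow> unitary M N h \<Longrightarrow> clinear_bounded h"
  by (rule ip_preserving_clinear_bounded) (auto simp: unitary_def)

lemma unitary_bij:
  assumes M: "hilbert_module M" and "unitary M N h"
  shows "bij h"
proof -
  interpret M: hilbert_module M by fact
  have "inj h"
    by (rule injI, rule M.eq_by_ip_self) (metis assms(2) unitary_def)+
  then show ?thesis using assms(2) by (simp add: unitary_def bij_def)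
qed

lemma unitary_inv:
  assumes M: "hilbert_module M" and h: "unitary M N h"
  shows "unitary N M (inv h)"
proof -
  have b: "bij h" by (rule unitary_bij[OF M h])
  then have "ip M (inv h x) (inv h y) = ip N x y" for x y
    using h by (metis unitary_def bij_inv_eq_iff)
  then show ?thesis using b by (simp add: unitary_def bij_imp_bij_inv bij_is_surj)
qed

lemma unitary_comp: "unitary L M g \<Longrightarrow> unitary M N h \<Longrightarrow> unitary L N (h \<circ> g)"
  by (simp add: unitary_def comp_def comp_surj[unfolded comp_def])


inductive_set graph_span :: "('m::complex_banach \<times> 'n::complex_banach) set \<Rightarrow> ('m \<times> 'n) set"
  for G where
  zero: "(0, 0) \<in> graph_span G"
| base: "mn \<in> G \<Longrightarrow> mn \<in> graph_span G"
| add: "(m, n) \<in> graph_span G \<Longrightarrow> (m', n') \<in> graph_span G \<Longrightarrow> (m + m', n + n') \<in> graph_span G"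
| scale: "(m, n) \<in> graph_span G \<Longrightarrow> (c *\<^sub>C m, c *\<^sub>C n) \<in> graph_span G"

lemma graph_span_domain:
  assumes "m \<in> module.span scaleC (fst ` G)"
  shows "\<exists>n. (m, n) \<in> graph_span G"
  using assms
proof (induction rule: complex_vector.span_induct_alt)
  case base
  then show ?case using graph_span.zero by blast
next
  case (step c x y)
  then obtain n n' where "(x, n) \<in> G" "(y, n') \<in> graph_span G" by auto
  then have "(c *\<^sub>C x + y, c *\<^sub>C n + n') \<in> graph_span G"
    by (intro graph_span.add[OF graph_span.scale[OF graph_span.base]])
  then show ?case by blast
qed

text \<open>Equality of the inner products makes the linear relation spanned by \<open>G\<close> isometric, so it is
  the graph of a map, and completeness extends this map from the dense span to the whole
  module.\<close>

lemma isometric_extension: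
  assumes M: "hilbert_module M" and N: "hilbert_module N"
    and total: "closed_cspan (fst ` G) = UNIV"
    and ip: "\<And>m n m' n'. (m, n) \<in> G \<Longrightarrow> (m', n') \<in> G \<Longrightarrow> ip N n n' = ip M m m'"
  obtains h where "\<And>m n. (m, n) \<in> G \<Longrightarrow> h m = n" and "\<And>x y. ip N (h x) (h y) = ip M x y"
proof -
  interpret M: hilbert_module M by fact
  interpret N: hilbert_module N by fact
  have ip1: "ip N n n' = ip M m m'" if "(m, n) \<in> graph_span G" "(m', n') \<in> G" for m n m' n'
    using that(1)
  proof (induction m n rule: graph_span.induct[split_format (complete)])
    case (base m n) then show ?case using ip that(2) by auto
  qed (auto simp: M.ip_add_left N.ip_add_left M.ip_scaleC_left N.ip_scaleC_left)
  have ip2: "ip N n n' = ip M m m'"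
    if "(m, n) \<in> graph_span G" "(m', n') \<in> graph_span G" for m n m' n'
    using that(2)
  proof (induction m' n' rule: graph_span.induct[split_format (complete)])
    case (base m' n') then show ?case using ip1 that(1) by auto
  qed (auto simp: M.ip_add N.ip_add M.ip_scaleC N.ip_scaleC)
  define L where "L x n \<longleftrightarrow> (\<exists>a b. (\<forall>k. (a k, b k) \<in> graph_span G) \<and> a \<longlonglongrightarrow> x \<and> b \<longlonglongrightarrow> n)" for x n
  have ipL: "ip N n n' = ip M x x'" if "L x n" "L x' n'" for x x' n n'
  proof -
    obtain a b a' b' where *: "\<And>k. (a k, b k) \<in> graph_span G" "a \<longlonglongrightarrow> x" "b \<longlonglongrightarrow> n"
      "\<And>k. (a' k, b' k) \<in> graph_span G" "a' \<longlonglongrightarrow> x'" "b' \<longlonglongrightarrow> n'"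
      using \<open>L x n\<close> \<open>L x' n'\<close> unfolding L_def by blast
    have "(\<lambda>k. ip M (a k) (a' k)) \<longlonglongrightarrow> ip M x x'"
      by (rule bounded_bilinear.tendsto[OF M.bounded_bilinear_ip *(2,5)])
    moreover have "(\<lambda>k. ip M (a k) (a' k)) \<longlonglongrightarrow> ip N n n'"
      using bounded_bilinear.tendsto[OF N.bounded_bilinear_ip *(3,6)] ip2[OF *(1,4)] by simp
    ultimately show ?thesis using LIMSEQ_unique by blast
  qed
  have exL: "\<exists>n. L x n" for x
  proof -
    have "x \<in> closed_cspan (fst ` G)" using total by simp
    then obtain a where a: "\<And>k. a k \<in> module.span scaleC (fst ` G)" "a \<longlonglongrightarrow> x"
      unfolding closure_sequential by blast
    obtain b where b: "\<And>k. (a k, b k) \<in> graph_span G"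
      using graph_span_domain[OF a(1)] by metis
    have "norm (b k - b l) = norm (a k - a l)" for k l
    proof -
      have "(a k - a l, b k - b l) \<in> graph_span G"
        using graph_span.add[OF b[of k] graph_span.scale[OF b[of l], of "-1"]]
        by (simp add: complex_vector.scale_minus_left)
      from ip2[OF this this] show ?thesis by (simp add: M.norm_ip N.norm_ip)
    qed
    then have "Cauchy b"
      using LIMSEQ_imp_Cauchy[OF a(2)] by (simp add: Cauchy_def dist_norm)
    then obtain n where "b \<longlonglongrightarrow> n" using Cauchy_convergent convergent_def by blast
    then show ?thesis using a b unfolding L_def by blast
  qed
  define h where "h x = (SOME n. L x n)" for x
  have L: "L x (h x)" for x unfolding h_def by (rule someI_ex[OF exL])
  show thesis
  proof (rule that)
    show "ip N (h x) (h y) = ip M x y" for x y by (rule ipL[OF L L])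
    fix m n assume "(m, n) \<in> G"
    then have "L m n"
      unfolding L_def using graph_span.base by (intro exI[of _ "\<lambda>_. m"] exI[of _ "\<lambda>_. n"]) auto
    then show "h m = n"
      using ipL[OF L L] ipL[OF L \<open>L m n\<close>] ipL[OF \<open>L m n\<close> L] ipL[OF \<open>L m n\<close> \<open>L m n\<close>]
      by (intro N.eq_by_ip_self) simp_all
  qed
qed

lemma map_given_by_eqI:
  assumes "closed_cspan (fst ` G) = UNIV" and h: "clinear_bounded h" "\<And>m n. (m, n) \<in> G \<Longrightarrow> h m = n"
  shows "map_given_by G = h"
  unfolding map_given_by_def
proof (rule the_equality)
  show "clinear_bounded h \<and> (\<forall>(m, n)\<in>G. h m = n)" using h by auto
  fix g assume g: "clinear_bounded g \<and> (\<forall>(m, n)\<in>G. g m = n)"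
  show "g = h"
  proof
    fix x show "g x = h x"
      by (rule clinear_bounded_eq_on_total[OF _ h(1) assms(1)]) (use g h in force)+
  qed
qed

text \<open>The range of an isometry of complete spaces is closed.\<close>

lemma isometric_surj:
  assumes M: "hilbert_module M" and N: "hilbert_module N"
    and ip: "\<And>x y. ip N (h x) (h y) = ip M x y"
    and total: "closed_cspan S = UNIV" "S \<subseteq> range h"
  shows "surj h"
proof -
  have h: "clinear_bounded h" by (rule ip_preserving_clinear_bounded[OF M N ip])
  have "complete (range h)"
    using h ip_preserving_norm[OF M N, of h] ip
    by (intro complete_isometric_image[of 1]) (auto simp: clinear_bounded_def complete_UNIV)
  then have closed: "closed (range h)" by (simp add: complete_eq_closed)
  have "y \<in> range h" for y
  proof -
    have "y \<in> closed_cspan S" using total(1) by simp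
    then show ?thesis
    proof (induction rule: closed_cspan_induct)
      case zero
      show ?case using clinear_bounded_zero[OF h] by (metis rangeI)
    next
      case (add x y)
      then obtain a b where "x = h a" "y = h b" by blast
      then have "x + y = h (a + b)" by (simp add: clinear_bounded_add[OF h])
      then show ?case by (rule range_eqI)
    next
      case (scale c x)
      then obtain a where "x = h a" by blast
      then have "c *\<^sub>C x = h (c *\<^sub>C a)" by (simp add: clinear_bounded_scaleC[OF h])
      then show ?case by (rule range_eqI)
    qed (use closed total(2) in auto)
  qed
  then show ?thesis by blast
qed

text \<open>The criterion by which every canonical identification is recognized as a well-defined unitary:
  only inner products of generators have to be compared.\<close>

lemma map_given_by_unitary:
  assumes M: "hilbert_module M" and N: "hilbert_module N"
    and total: "closed_cspan (fst ` G) = UNIV" "closed_cspan (snd ` G) = UNIV"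
    and ip: "\<And>m n m' n'. (m, n) \<in> G \<Longrightarrow> (m', n') \<in> G \<Longrightarrow> ip N n n' = ip M m m'"
  shows "unitary M N (map_given_by G)" and "(m, n) \<in> G \<Longrightarrow> map_given_by G m = n"
proof -
  obtain h where h: "\<And>m n. (m, n) \<in> G \<Longrightarrow> h m = n" "\<And>x y. ip N (h x) (h y) = ip M x y"
    using isometric_extension[OF M N total(1) ip] by blast
  have "clinear_bounded h"
    by (rule ip_preserving_clinear_bounded[OF M N]) (rule h(2))
  then have eq: "map_given_by G = h"
    by (rule map_given_by_eqI[OF total(1)]) (rule h(1))
  have "surj h"
    by (rule isometric_surj[OF M N h(2) total(2)]) (use h(1) in force)
  then show "unitary M N (map_given_by G)"
    using h(2) by (simp add: eq unitary_def)
  show "(m, n) \<in> G \<Longrightarrow> map_given_by G m = n" using h(1) by (simp add: eq)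
qed

section \<open>Tensor products\<close>


lemma correspondence_hilbert_module: "correspondence A F \<Longrightarrow> hilbert_module F"
  by (simp add: correspondence_def)

lemma whole_simps [simp]: "acarrier whole_algebra = UNIV" "amult whole_algebra = (*)" "astar whole_algebra = star"
  by (simp_all add: whole_algebra_def)

lemma adj_algebra_simps [simp]: "acarrier (adj_algebra E) = adjointables E" "amult (adj_algebra E) = (o\<^sub>L)"
  "astar (adj_algebra E) = adj E"
  by (simp_all add: adj_algebra_def)

lemma rep_corr_simps [simp]: "ip (rep_corr F \<theta>) = ip F" "ract (rep_corr F \<theta>) = ract F"
  "lact (rep_corr F \<theta>) a = blinfun_apply (\<theta> a)"
  by (simp_all add: rep_corr_def)

lemma dual_corr_simps [simp]: "ip (dual_corr E) (Dual x) (Dual y) = rank_one E x y"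
  "lact (dual_corr E) b (Dual x) = Dual (ract E x (star b))"
  by (simp_all add: dual_corr_def Dual_inverse)

lemma self_corr_simps [simp]: "ip self_corr b b' = star b * b'" "lact self_corr = (*)"
  by (simp_all add: self_corr_def)

lemma hilbert_module_rep_corr: "hilbert_module F \<Longrightarrow> hilbert_module (rep_corr F \<theta>)"
  by (simp add: hilbert_module_def)

lemma hilbert_module_self_corr: "hilbert_module (self_corr :: ('b::cstar_algebra, 'b, 'b) corr)"
proof
  fix x :: 'b
  have "norm x = sqrt (norm (star x * x))" by (simp add: cstar_identity)
  then show "norm x = sqrt (norm (ip self_corr x x))" by simp
  show "x = 0" if "ip self_corr x x = 0" using that cstar_identity[of x] by simp
  show "\<exists>b. ip self_corr x x = star b * b" by auto
qed (simp_all add: self_corr_def algebra_simps mult_scaleC_left mult_scaleC_right star_mult star_star)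

lemma clinear_bounded_lact_left:
  assumes "correspondence whole_algebra F"
  shows "clinear_bounded (\<lambda>b. lact F b y)"
proof -
  interpret correspondence whole_algebra F by fact
  show ?thesis
    using norm_lact_le[OF banach_star_algebra_whole]
    by (intro clinear_boundedI[where K = "2 * norm y"]) (auto simp: lact_add lact_scaleC ac_simps)
qed

text \<open>By fullness every \<open>b\<close> is a limit of sums of inner products, the action is continuous in \<open>b\<close>, and
  \<open>\<B> F\<close> is total by nondegeneracy.\<close>

lemma total_pairing_action:
  assumes F: "correspondence whole_algebra F" and "full E"
  shows "closed_cspan {lact F (ip E x x') y | x x' y. True} = UNIV"
proof (rule total_trans)
  show "closed_cspan {lact F b y | b y. b \<in> acarrier whole_algebra} = UNIV"
    by (rule correspondence.nondegenerate[OF F])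
  fix z assume "z \<in> {lact F b y | b y. b \<in> acarrier whole_algebra}"
  then obtain b y where z: "z = lact F b y" by blast
  have "b \<in> closed_cspan {ip E x x' | x x'. True}" using \<open>full E\<close> by (simp add: full_def)
  then show "z \<in> closed_cspan {lact F (ip E x x') y | x x' y. True}"
    unfolding z
    by (rule closed_cspan_image[OF clinear_bounded_lact_left[OF F]]) (auto intro!: closed_cspan_base)
qed

lemma
  assumes "tensor_product A E F T t"
  shows tensor_correspondence: "correspondence A T"
    and tensor_hilbert_module: "hilbert_module T"
    and tensor_ip: "ip T (t x y) (t x' y') = ip F y (lact F (ip E x x') y')"
    and tensor_total: "closed_cspan {t x y | x y. True} = UNIV"
    and tensor_lact: "a \<in> acarrier A \<Longrightarrow> lact T a (t x y) = t (lact E a x) y"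
  using assms correspondence_hilbert_module by (auto simp: tensor_product_def)

lemma tensor_eq_by_ip:
  assumes "tensor_product A E F T t" and "\<And>x y. ip T (t x y) z = ip T (t x y) z'"
  shows "z = z'"
  by (rule hilbert_module.eq_by_ip_total[OF tensor_hilbert_module[OF assms(1)] tensor_total[OF assms(1)]])
     (use assms(2) in auto)

text \<open>Continuity in the second factor follows from
  \<open>\<parallel>x \<odot> y\<parallel>\<^sup>2 = \<parallel>\<langle>y, \<langle>x, x\<rangle> y\<rangle>\<parallel>\<close> since \<open>\<langle>x, x\<rangle>\<close> acts as a bounded operator. In the first factor the bound
  has to be uniform in the acting element.\<close>

lemma tensor_clinear_right:
  assumes T: "tensor_product A E F T t" and F: "correspondence A' F" and A': "banach_star_algebra A' K"
    and in': "\<And>x y. ip E x y \<in> acarrier A'"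
  shows "clinear_bounded (t x)"
proof -
  interpret F: correspondence A' F by fact
  interpret T: hilbert_module T by (rule tensor_hilbert_module[OF T])
  note lin = F.lact_add_right[OF A' in'] F.lact_scaleC_right[OF A' in']
  define C where "C = 4 * (1 + K) * norm (ip E x x)"
  have bound: "(norm (t x y))\<^sup>2 \<le> (norm y)\<^sup>2 * C" for y
  proof -
    have "(norm (t x y))\<^sup>2 = norm (ip F y (lact F (ip E x x) y))"
      by (simp add: T.norm_power2_ip tensor_ip[OF T])
    also have "\<dots> \<le> norm y * norm (lact F (ip E x x) y) * 4" by (rule F.norm_ip_le)
    also have "\<dots> \<le> norm y * ((1 + K) * norm (ip E x x) * norm y) * 4"
      by (intro mult_right_mono mult_left_mono F.norm_lact_le[OF A' in']) auto
    finally show ?thesis by (simp add: C_def power2_eq_square algebra_simps)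
  qed
  show ?thesis
  proof (rule clinear_boundedI[where K = "sqrt C"])
    show "t x (y + z) = t x y + t x z" for y z
      by (rule tensor_eq_by_ip[OF T]) (simp add: T.ip_add tensor_ip[OF T] lin F.ip_add)
    show "t x (c *\<^sub>C y) = c *\<^sub>C t x y" for c y
      by (rule tensor_eq_by_ip[OF T]) (simp add: T.ip_scaleC tensor_ip[OF T] lin F.ip_scaleC)
    show "norm (t x y) \<le> norm y * sqrt C" for y
      using real_le_rsqrt[OF bound[of y]] by (simp add: real_sqrt_mult)
  qed
qed

lemma tensor_clinear_left:
  assumes T: "tensor_product A E F T t" and E: "hilbert_module E" and F: "correspondence whole_algebra F"
  shows "clinear_bounded (\<lambda>x. t x y)"
proof -
  interpret E: hilbert_module E by fact
  interpret F: correspondence whole_algebra F by fact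
  interpret T: hilbert_module T by (rule tensor_hilbert_module[OF T])
  have bound: "(norm (t x y))\<^sup>2 \<le> (norm x)\<^sup>2 * (8 * (norm y)\<^sup>2)" for x
  proof -
    have "(norm (t x y))\<^sup>2 = norm (ip F y (lact F (ip E x x) y))"
      by (simp add: T.norm_power2_ip tensor_ip[OF T])
    also have "\<dots> \<le> norm y * norm (lact F (ip E x x) y) * 4" by (rule F.norm_ip_le)
    also have "\<dots> \<le> norm y * ((1 + 1) * norm (ip E x x) * norm y) * 4"
      by (intro mult_right_mono mult_left_mono F.norm_lact_le[OF banach_star_algebra_whole]) auto
    finally show ?thesis by (simp add: E.norm_power2_ip[symmetric] power2_eq_square ac_simps)
  qed
  show ?thesis
  proof (rule clinear_boundedI[where K = "sqrt (8 * (norm y)\<^sup>2)"])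
    show "t (x + x') y = t x y + t x' y" for x x'
      by (rule tensor_eq_by_ip[OF T]) (simp add: T.ip_add tensor_ip[OF T] E.ip_add F.lact_add F.ip_add)
    show "t (c *\<^sub>C x) y = c *\<^sub>C t x y" for c x
      by (rule tensor_eq_by_ip[OF T])
         (simp add: T.ip_scaleC tensor_ip[OF T] E.ip_scaleC F.lact_scaleC F.ip_scaleC)
    show "norm (t x y) \<le> norm x * sqrt (8 * (norm y)\<^sup>2)" for x
      using real_le_rsqrt[OF bound[of x]] by (simp add: real_sqrt_mult)
  qed
qed

lemma tensor_balanced:
  assumes T: "tensor_product A E F T t" and E: "hilbert_module E" and F: "correspondence whole_algebra F"
  shows "t (ract E x b) y = t x (lact F b y)"
  by (rule tensor_eq_by_ip[OF T])
     (use correspondence.lact_mult[OF F] in \<open>simp add: tensor_ip[OF T] hilbert_module.ip_ract[OF E]\<close>)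

text \<open>If \<open>E\<close> is full, \<open>E \<odot> F\<close> separates the elements of \<open>F\<close>: the inner products of \<open>y\<close> with the
  total vectors \<open>\<langle>x, x'\<rangle> y'\<close> are those of \<open>x \<odot> y\<close> with \<open>x' \<odot> y'\<close>.\<close>

lemma tensor_cancel:
  assumes T: "tensor_product A E F T t" and F: "correspondence whole_algebra F" and "full E"
    and eq: "\<And>x. t x y = t x z"
  shows "y = z"
proof (rule hilbert_module.eq_by_ip_total[OF _ total_pairing_action[OF F \<open>full E\<close>]])
  interpret F: correspondence whole_algebra F by fact
  show "hilbert_module F" by unfold_locales
  fix w assume "w \<in> {lact F (ip E x x') y | x x' y. True}"
  then obtain x x' y' where w: "w = lact F (ip E x x') y'" by blast
  have "ip F y w = ip F z w"
    by (metis w eq tensor_ip[OF T])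
  then show "ip F w y = ip F w z" by (metis F.ip_star)
qed

lemma tensor_map_unitary:
  assumes T: "tensor_product A E F T t" and T': "tensor_product A' E' F' T' t'"
    and surj: "surj g" "surj h"
    and ip: "\<And>x y x' y'. ip F' (h y) (lact F' (ip E' (g x) (g x')) (h y')) = ip F y (lact F (ip E x x') y')"
  shows "unitary T T' (tensor_map t t' g h)" and "tensor_map t t' g h (t x y) = t' (g x) (h y)"
proof -
  let ?G = "{(t x y, t' (g x) (h y)) | x y. True}"
  have 1: "closed_cspan (fst ` ?G) = UNIV"
  proof -
    have "fst ` ?G = {t x y | x y. True}" by force
    then show ?thesis using tensor_total[OF T] by simp
  qed
  have 2: "closed_cspan (snd ` ?G) = UNIV"
  proof -
    have "{t' x y | x y. True} \<subseteq> snd ` ?G"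
    proof clarify
      fix x' y'
      obtain x y where "x' = g x" "y' = h y" using surj by (metis surjD)
      then show "t' x' y' \<in> snd ` ?G" by force
    qed
    moreover have "snd ` ?G \<subseteq> {t' x y | x y. True}" by force
    ultimately have "snd ` ?G = {t' x y | x y. True}" by simp
    then show ?thesis using tensor_total[OF T'] by simp
  qed
  have 3: "ip T' n n' = ip T m m'" if "(m, n) \<in> ?G" "(m', n') \<in> ?G" for m n m' n'
    using that ip by (auto simp: tensor_ip[OF T] tensor_ip[OF T'])
  note * = map_given_by_unitary[OF tensor_hilbert_module[OF T] tensor_hilbert_module[OF T'] 1 2 3]
  show "unitary T T' (tensor_map t t' g h)" unfolding tensor_map_def by (rule *(1))
  show "tensor_map t t' g h (t x y) = t' (g x) (h y)" unfolding tensor_map_def by (rule *(2)) auto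
qed

section \<open>The canonical identifications\<close>

lemma unit_ident_unitary:
  assumes S: "tensor_product whole_algebra self_corr F S s" and F: "correspondence whole_algebra F"
  shows "unitary S F (unit_ident F s)" and "unit_ident F s (s b y) = lact F b y"
proof -
  interpret F: correspondence whole_algebra F by fact
  let ?G = "{(s b y, lact F b y) | b y. True}"
  have 1: "closed_cspan (fst ` ?G) = UNIV"
  proof -
    have "fst ` ?G = {s x y | x y. True}" by force
    then show ?thesis using tensor_total[OF S] by simp
  qed
  have 2: "closed_cspan (snd ` ?G) = UNIV"
  proof -
    have "snd ` ?G = {lact F b y | b y. b \<in> acarrier whole_algebra}" by force
    then show ?thesis using F.nondegenerate by simp
  qed
  have "ip F (lact F b y) (lact F b' y') = ip F y (lact F (star b * b') y')" for b b' y y'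
    using F.lact_star[of b y] F.lact_mult[of "star b" b' y'] by simp
  then have 3: "ip F n n' = ip S m m'" if "(m, n) \<in> ?G" "(m', n') \<in> ?G" for m n m' n'
    using that by (auto simp: tensor_ip[OF S])
  note * = map_given_by_unitary[OF tensor_hilbert_module[OF S] correspondence_hilbert_module[OF F] 1 2 3]
  show "unitary S F (unit_ident F s)" unfolding unit_ident_def by (rule *(1))
  show "unit_ident F s (s b y) = lact F b y" unfolding unit_ident_def by (rule *(2)) auto
qed

lemma pairing_ident_unitary:
  fixes E :: "('e::complex_banach, 'b::cstar_algebra) hilbert_mod"
  assumes E: "hilbert_module E" "full E"
    and P: "tensor_product whole_algebra (dual_corr E) (op_corr E) P p"
  shows "unitary P self_corr (pairing_ident E p)" and "pairing_ident E p (p (Dual x) x') = ip E x x'"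
proof -
  interpret E: hilbert_module E by fact
  let ?G = "{(p (Dual x) x', ip E x x') | x x'. True}"
  have 1: "closed_cspan (fst ` ?G) = UNIV"
  proof -
    have "{p x y | x y. True} \<subseteq> fst ` ?G"
    proof clarify
      fix x y
      have "(p (Dual (undual x)) y, ip E (undual x) y) \<in> ?G" by blast
      then show "p x y \<in> fst ` ?G" by (force simp: undual_inverse)
    qed
    moreover have "fst ` ?G \<subseteq> {p x y | x y. True}" by force
    ultimately have "fst ` ?G = {p x y | x y. True}" by simp
    then show ?thesis using tensor_total[OF P] by simp
  qed
  have 2: "closed_cspan (snd ` ?G) = UNIV"
  proof -
    have "snd ` ?G = {ip E x y | x y. True}" by force
    then show ?thesis using E(2) by (simp add: full_def)
  qed
  have 3: "ip self_corr n n' = ip P m m'" if "(m, n) \<in> ?G" "(m', n') \<in> ?G" for m n m' n'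
    using that by (auto simp: tensor_ip[OF P] E.rank_one_apply E.ip_ract E.ip_star)
  note * = map_given_by_unitary[OF tensor_hilbert_module[OF P] hilbert_module_self_corr 1 2 3]
  show "unitary P self_corr (pairing_ident E p)" unfolding pairing_ident_def by (rule *(1))
  show "pairing_ident E p (p (Dual x) x') = ip E x x'" unfolding pairing_ident_def by (rule *(2)) auto
qed


lemma dual_tensor_clinear:
  assumes E: "hilbert_module E" and T: "correspondence (adj_algebra E) T"
    and R: "tensor_product A (dual_corr E) T R r"
  shows "clinear_bounded (r x)"
  by (rule tensor_clinear_right[OF R T banach_star_algebra_adj[OF E]])
     (metis Dual_cases E adj_algebra_simps(1) dual_corr_simps(1) hilbert_module.rank_one_adjointable)

lemma op_tensor_clinear:
  assumes T: "tensor_product A (op_corr E) F T t" and F: "correspondence whole_algebra F"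
  shows "clinear_bounded (t x)"
  by (rule tensor_clinear_right[OF T F banach_star_algebra_whole]) simp

text \<open>That is, \<open>(x z\<^sup>*)(x' \<odot> y) = x \<langle>z, x'\<rangle> \<odot> y = x \<odot> \<langle>z, x'\<rangle> y\<close>.\<close>

lemma lact_rank_one:
  assumes E: "hilbert_module E" and T: "tensor_product (adj_algebra E) (op_corr E) F T t"
    and F: "correspondence whole_algebra F"
  shows "lact T (rank_one E x z) (t x' y) = t x (lact F (ip E z x') y)"
  using tensor_balanced[OF T hilbert_module_rep_corr[OF E] F]
  by (simp add: tensor_lact[OF T] hilbert_module.rank_one_adjointable[OF E] hilbert_module.rank_one_apply[OF E])

lemma assoc_ident_unitary:
  fixes E :: "('e::complex_banach, 'b::cstar_algebra) hilbert_mod"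
  assumes E: "hilbert_module E"
    and P: "tensor_product whole_algebra (dual_corr E) (op_corr E) P p"
    and F: "correspondence whole_algebra F"
    and T: "tensor_product (adj_algebra E) (op_corr E) F T t"
    and Q: "tensor_product whole_algebra P F Q q"
    and R: "tensor_product whole_algebra (dual_corr E) T R r"
  shows "unitary Q R (assoc_ident p t q r)" and "assoc_ident p t q r (q (p x x') y) = r x (t x' y)"
proof -
  interpret E: hilbert_module E by fact
  let ?G = "{(q (p x x') y, r x (t x' y)) | x x' y. True}"
  have 1: "closed_cspan (fst ` ?G) = UNIV"
  proof (rule total_trans[OF tensor_total[OF Q]])
    fix w assume "w \<in> {q x y | x y. True}"
    then obtain m y where w: "w = q m y" by blast
    have "m \<in> closed_cspan {p x x' | x x'. True}" using tensor_total[OF P] by simp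
    then show "w \<in> closed_cspan (fst ` ?G)"
      unfolding w
      by (rule closed_cspan_image[OF tensor_clinear_left[OF Q tensor_hilbert_module[OF P] F]])
         (rule closed_cspan_base, force)
  qed
  have 2: "closed_cspan (snd ` ?G) = UNIV"
  proof (rule total_trans[OF tensor_total[OF R]])
    fix w assume "w \<in> {r x y | x y. True}"
    then obtain x m where w: "w = r x m" by blast
    have "m \<in> closed_cspan {t x y | x y. True}" using tensor_total[OF T] by simp
    then show "w \<in> closed_cspan (snd ` ?G)"
      unfolding w
      by (rule closed_cspan_image[OF dual_tensor_clinear[OF E tensor_correspondence[OF T] R]])
         (rule closed_cspan_base, force)
  qed
  have "ip R (r x (t x' y)) (r z (t z' y')) = ip Q (q (p x x') y) (q (p z z') y')" for x x' y z z' y'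
    by (cases x; cases z)
       (simp add: tensor_ip[OF R] tensor_ip[OF Q] tensor_ip[OF P] tensor_ip[OF T] tensor_lact[OF T]
         E.rank_one_adjointable)
  then have 3: "ip R n n' = ip Q m m'" if "(m, n) \<in> ?G" "(m', n') \<in> ?G" for m n m' n'
    using that by auto
  note * = map_given_by_unitary[OF tensor_hilbert_module[OF Q] tensor_hilbert_module[OF R] 1 2 3]
  show "unitary Q R (assoc_ident p t q r)" unfolding assoc_ident_def by (rule *(1))
  show "assoc_ident p t q r (q (p x x') y) = r x (t x' y)" unfolding assoc_ident_def by (rule *(2)) auto
qed

text \<open>The contraction sends \<open>x\<^sup>* \<odot> x' \<odot> y\<close> to \<open>\<langle>x, x'\<rangle> \<odot> y\<close>; as a composition of an isometric
  surjection with the inverse of another it is unitary.\<close>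

lemma contract_unitary:
  fixes E :: "('e::complex_banach, 'b::cstar_algebra) hilbert_mod"
  assumes E: "hilbert_module E" "full E"
    and P: "tensor_product whole_algebra (dual_corr E) (op_corr E) P p"
    and F: "correspondence whole_algebra F"
    and chain: "tensor_chain E P F T t S s Q q R r"
  shows "unitary R S (contract E p t s q r)"
    and "contract E p t s q r (r (Dual x) (t x' y)) = s (ip E x x') y"
proof -
  have T: "tensor_product (adj_algebra E) (op_corr E) F T t"
    and S: "tensor_product whole_algebra self_corr F S s"
    and Q: "tensor_product whole_algebra P F Q q"
    and R: "tensor_product whole_algebra (dual_corr E) T R r"
    using chain by (auto simp: tensor_chain_def)
  note assoc = assoc_ident_unitary[OF E(1) P F T Q R]
  note pair = pairing_ident_unitary[OF E P]
  have ip: "ip F (id y) (lact F (ip self_corr (pairing_ident E p m) (pairing_ident E p m')) (id y')) =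
      ip F y (lact F (ip P m m') y')" for y y' m m'
    using pair(1) unfolding unitary_def by simp
  have surj: "surj (pairing_ident E p)" using pair(1) by (simp add: unitary_def)
  note tm = tensor_map_unitary[OF Q S surj surj_id ip]
  show "unitary R S (contract E p t s q r)"
    unfolding contract_def by (rule unitary_comp[OF unitary_inv[OF tensor_hilbert_module[OF Q] assoc(1)] tm(1)])
  have "inv (assoc_ident p t q r) (r (Dual x) (t x' y)) = q (p (Dual x) x') y"
    using unitary_bij[OF tensor_hilbert_module[OF Q] assoc(1)] assoc(2) by (metis bij_inv_eq_iff)
  then show "contract E p t s q r (r (Dual x) (t x' y)) = s (ip E x x') y"
    unfolding contract_def by (simp add: tm(2) pair(2))
qed

text \<open>Following the contraction \<open>E\<^sup>* \<odot> (E \<odot> F) \<rightarrow> F\<close> by \<open>x' \<odot> -\<close> gives the action of a rank-one operator: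
  for \<open>m = z \<odot> y\<close> both sides are \<open>x' \<odot> \<langle>x, z\<rangle> y\<close>, and both sides are continuous and linear in \<open>m\<close>. Since
  \<open>m\<close> is arbitrary, it may be a value of a unitary into \<open>E \<odot> F\<close> about which nothing is known but that it
  intertwines the actions of \<open>B\<^sup>a(E)\<close>.\<close>

lemma tensor_contract:
  fixes E :: "('e::complex_banach, 'b::cstar_algebra) hilbert_mod"
  assumes E: "hilbert_module E" "full E"
    and P: "tensor_product whole_algebra (dual_corr E) (op_corr E) P p"
    and F: "correspondence whole_algebra F"
    and chain: "tensor_chain E P F T t S s Q q R r"
  shows "t x' (unit_ident F s (contract E p t s q r (r (Dual x) m))) = lact T (rank_one E x' x) m"
proof -
  have T: "tensor_product (adj_algebra E) (op_corr E) F T t"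
    and S: "tensor_product whole_algebra self_corr F S s"
    and R: "tensor_product whole_algebra (dual_corr E) T R r"
    using chain by (auto simp: tensor_chain_def)
  have hm: "hilbert_module T" "hilbert_module R" "hilbert_module S" "hilbert_module F"
    using tensor_hilbert_module T R S correspondence_hilbert_module F by blast+
  note con = contract_unitary[OF E P F chain] and unit = unit_ident_unitary[OF S F]
  have lin: "clinear_bounded (\<lambda>m. t x' (unit_ident F s (contract E p t s q r (r (Dual x) m))))"
      by (intro clinear_bounded_compose[OF op_tensor_clinear[OF T F]]
          clinear_bounded_compose[OF unitary_clinear_bounded[OF hm(3,4) unit(1)]]
          clinear_bounded_compose[OF unitary_clinear_bounded[OF hm(2,3) con(1)]]
          dual_tensor_clinear[OF E(1) tensor_correspondence[OF T] R])
  have lin': "clinear_bounded (lact T (rank_one E x' x))"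
      using correspondence.clinear_bounded_lact[OF tensor_correspondence[OF T] banach_star_algebra_adj[OF E(1)]]
        hilbert_module.rank_one_adjointable[OF E(1)] by simp
  show ?thesis
  proof (rule clinear_bounded_eq_on_total[OF lin lin' tensor_total[OF T]])
    fix m assume "m \<in> {t x y | x y. True}"
    then show "t x' (unit_ident F s (contract E p t s q r (r (Dual x) m))) = lact T (rank_one E x' x) m"
      by (auto simp: con(2) unit(2) lact_rank_one[OF E(1) T F])
  qed
qed

section \<open>The induced isomorphism\<close>

lemma tensor_map_id_eqI:
  assumes T1: "tensor_product A E F1 T1 t1" and u: "clinear_bounded u"
    and "\<And>x y. u (t1 x y) = t2 x (v y)"
  shows "tensor_map t1 t2 id v = u"
  unfolding tensor_map_def
proof (rule map_given_by_eqI[OF _ u])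
  have "fst ` {(t1 x y, t2 (id x) (v y)) | x y. True} = {t1 x y | x y. True}" by force
  then show "closed_cspan (fst ` {(t1 x y, t2 (id x) (v y)) | x y. True}) = UNIV"
    using tensor_total[OF T1] by simp
  show "u m = n" if "(m, n) \<in> {(t1 x y, t2 (id x) (v y)) | x y. True}" for m n
    using that assms(3) by auto
qed

lemma tensor_map_id_apply:
  assumes T1: "tensor_product A E F1 T1 t1" and T2: "tensor_product A' E F2 T2 t2"
    and w: "corr_iso whole_algebra F1 F2 w"
  shows "tensor_map t1 t2 id w (t1 x y) = t2 x (w y)"
proof -
  have "ip F2 (w y) (lact F2 (ip E (id x) (id x')) (w y')) = ip F1 y (lact F1 (ip E x x') y')" for x y x' y'
    using w by (simp add: corr_iso_def unitary_def) metis
  then show ?thesis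
    using tensor_map_unitary(2)[OF T1 T2 surj_id, of w x y] w by (simp add: corr_iso_def unitary_def)
qed

text \<open>On the total set of vectors \<open>\<langle>z, x'\<rangle> y\<close> the composition \<open>v\<close> can be computed, and
  \<open>x \<odot> v (\<langle>z, x'\<rangle> y) = (x z\<^sup>*) u (x' \<odot> y) = u ((x z\<^sup>*)(x' \<odot> y)) = u (x \<odot> \<langle>z, x'\<rangle> y)\<close>. Hence \<open>id \<odot> v = u\<close>.
  Everything else follows by cancelling \<open>x\<close>: uniqueness, and left linearity because
  \<open>x \<odot> v (b y) = u (x b \<odot> y) = x b \<odot> v y = x \<odot> b (v y)\<close>.\<close>

proposition induced_isomorphism:
  fixes E :: "('e::complex_banach, 'b::cstar_algebra) hilbert_mod"
  assumes E: "hilbert_module E" "full E"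
    and P: "tensor_product whole_algebra (dual_corr E) (op_corr E) P p"
    and F1: "correspondence whole_algebra F1"
    and chain1: "tensor_chain E P F1 T1 t1 S1 s1 Q1 q1 R1 r1"
    and F2: "correspondence whole_algebra F2"
    and chain2: "tensor_chain E P F2 T2 t2 S2 s2 Q2 q2 R2 r2"
    and u: "corr_iso (adj_algebra E) T1 T2 u"
  defines "v \<equiv> induced_map E p F1 t1 s1 q1 r1 F2 t2 s2 q2 r2 u"
  shows "corr_iso whole_algebra F1 F2 v"
    and "tensor_map t1 t2 id v = u"
    and "corr_iso whole_algebra F1 F2 w \<Longrightarrow> tensor_map t1 t2 id w = u \<Longrightarrow> w = v"
proof -
  interpret E: hilbert_module E by fact
  have T1: "tensor_product (adj_algebra E) (op_corr E) F1 T1 t1"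
    and S1: "tensor_product whole_algebra self_corr F1 S1 s1"
    and R1: "tensor_product whole_algebra (dual_corr E) T1 R1 r1"
    using chain1 by (auto simp: tensor_chain_def)
  have T2: "tensor_product (adj_algebra E) (op_corr E) F2 T2 t2"
    and S2: "tensor_product whole_algebra self_corr F2 S2 s2"
    and R2: "tensor_product whole_algebra (dual_corr E) T2 R2 r2"
    using chain2 by (auto simp: tensor_chain_def)
  have hm: "hilbert_module T1" "hilbert_module R1" "hilbert_module S1" "hilbert_module F1"
    "hilbert_module T2" "hilbert_module R2" "hilbert_module S2" "hilbert_module F2"
    using tensor_hilbert_module T1 R1 S1 F1 T2 R2 S2 F2 correspondence_hilbert_module by blast+
  note con1 = contract_unitary[OF E P F1 chain1] and unit1 = unit_ident_unitary[OF S1 F1]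
  note con2 = contract_unitary[OF E P F2 chain2] and unit2 = unit_ident_unitary[OF S2 F2]
  have uu: "unitary T1 T2 u" and ul: "\<And>a m. a \<in> adjointables E \<Longrightarrow> u (lact T1 a m) = lact T2 a (u m)"
    using u by (auto simp: corr_iso_def)
  have ulin: "clinear_bounded u" by (rule unitary_clinear_bounded[OF hm(1,5) uu])
  have ip: "ip T2 (u m) (lact T2 (ip (dual_corr E) (id x) (id x')) (u m')) =
      ip T1 m (lact T1 (ip (dual_corr E) x x') m')" for m m' x x'
    using uu by (cases x; cases x') (simp add: unitary_def ul[symmetric] E.rank_one_adjointable)
  have "surj u" using uu by (simp add: unitary_def)
  note tm = tensor_map_unitary[OF R1 R2 surj_id this ip]
  have vu: "unitary F1 F2 v"
    unfolding v_def induced_map_def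
    by (intro unitary_comp[OF unitary_inv[OF hm(3) unit1(1)]] unitary_comp[OF unitary_inv[OF hm(2) con1(1)]]
        unitary_comp[OF tm(1)] unitary_comp[OF con2(1)] unit2(1))
  have vlin: "clinear_bounded v" by (rule unitary_clinear_bounded[OF hm(4,8) vu])
  have v_apply: "v (lact F1 (ip E x x') y) =
      unit_ident F2 s2 (contract E p t2 s2 q2 r2 (r2 (Dual x) (u (t1 x' y))))" for x x' y
  proof -
    have "inv (unit_ident F1 s1) (lact F1 (ip E x x') y) = s1 (ip E x x') y"
      using unitary_bij[OF hm(3) unit1(1)] unit1(2) by (metis bij_inv_eq_iff)
    moreover have "inv (contract E p t1 s1 q1 r1) (s1 (ip E x x') y) = r1 (Dual x) (t1 x' y)"
      using unitary_bij[OF hm(2) con1(1)] con1(2) by (metis bij_inv_eq_iff)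
    ultimately show ?thesis by (simp add: v_def induced_map_def tm(2))
  qed
  have u_apply: "u (t1 x y) = t2 x (v y)" for x y
  proof (rule clinear_bounded_eq_on_total[OF _ _ total_pairing_action[OF F1 E(2)]])
    show "clinear_bounded (\<lambda>y. u (t1 x y))"
      by (intro clinear_bounded_compose[OF ulin] op_tensor_clinear[OF T1 F1])
    show "clinear_bounded (\<lambda>y. t2 x (v y))"
      by (intro clinear_bounded_compose[OF _ vlin] op_tensor_clinear[OF T2 F2])
    fix w assume "w \<in> {lact F1 (ip E x x') y | x x' y. True}"
    then obtain z x' y where w: "w = lact F1 (ip E z x') y" by blast
    have "t2 x (v w) = lact T2 (rank_one E x z) (u (t1 x' y))"
      unfolding w v_apply by (rule tensor_contract[OF E P F2 chain2])
    also have "\<dots> = u (lact T1 (rank_one E x z) (t1 x' y))"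
      by (simp add: ul E.rank_one_adjointable)
    finally show "u (t1 x w) = t2 x (v w)"
      by (simp add: w lact_rank_one[OF E(1) T1 F1])
  qed
  note bal1 = tensor_balanced[OF T1 hilbert_module_rep_corr[OF E(1)] F1, unfolded rep_corr_simps]
  note bal2 = tensor_balanced[OF T2 hilbert_module_rep_corr[OF E(1)] F2, unfolded rep_corr_simps]
  have fullop: "full (op_corr E)" using E(2) by (simp add: full_def)
  have "v (lact F1 b y) = lact F2 b (v y)" for b y
    by (rule tensor_cancel[OF T2 F2 fullop]) (metis u_apply bal1 bal2)
  then show iso: "corr_iso whole_algebra F1 F2 v"
    using vu by (simp add: corr_iso_def)
  show "tensor_map t1 t2 id v = u"
    by (rule tensor_map_id_eqI[OF T1 ulin]) (rule u_apply)
  show "w = v" if w: "corr_iso whole_algebra F1 F2 w" "tensor_map t1 t2 id w = u"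
  proof
    fix y
    show "w y = v y"
      by (rule tensor_cancel[OF T2 F2 fullop]) (metis u_apply w tensor_map_id_apply[OF T1 T2 w(1)])
  qed
qed

section \<open>Representations of the adjointable operators\<close>

lemma unital_rep_correspondence:
  assumes E: "hilbert_module E" and F: "hilbert_module F" and \<theta>: "unital_rep E F \<theta>"
  shows "correspondence (adj_algebra E) (rep_corr F \<theta>)"
proof -
  interpret E: hilbert_module E by fact
  interpret F: hilbert_module F by fact
  have id: "id_blinfun \<in> adjointables E" by (rule E.adjointablesI[of _ id_blinfun]) simp
  have "y \<in> closed_cspan {blinfun_apply (\<theta> a) y | a y. a \<in> adjointables E}" for y
  proof (rule closed_cspan_base)
    have "blinfun_apply (\<theta> id_blinfun) y = y" using \<theta> by (simp add: unital_rep_def)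
    then show "y \<in> {blinfun_apply (\<theta> a) y | a y. a \<in> adjointables E}"
      using id by (metis (mono_tags, lifting) mem_Collect_eq)
  qed
  then have "closed_cspan {blinfun_apply (\<theta> a) y | a y. a \<in> adjointables E} = UNIV" by blast
  then show ?thesis
    using \<theta> hilbert_module_rep_corr[OF F, of \<theta>]
    by (simp add: correspondence_def correspondence_axioms_def unital_rep_def blinfun.add_left
        scaleC_blinfun.rep_eq F.adj)
qed

text \<open>The vectors \<open>\<theta>(x\<^sub>1 x\<^sub>2\<^sup>*) y\<close> are total in \<open>F\<close> because \<open>F\<close> is isomorphic to \<open>E \<odot> F\<^sub>1\<close>, where the
  vectors \<open>(x z\<^sup>*)(x' \<odot> y) = x \<odot> \<langle>z, x'\<rangle> y\<close> are total.\<close>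

lemma rep_ident_corr_iso:
  fixes E :: "('e::complex_banach, 'b::cstar_algebra) hilbert_mod"
  assumes E: "hilbert_module E" "full E"
    and F1: "correspondence whole_algebra F1"
    and T1: "tensor_product (adj_algebra E) (op_corr E) F1 T1 t1"
    and F: "hilbert_module F" and \<theta>: "unital_rep E F \<theta>"
    and G: "tensor_product whole_algebra (dual_corr E) (rep_corr F \<theta>) G g"
    and T: "tensor_product (adj_algebra E) (op_corr E) G T t"
    and u: "corr_iso (adj_algebra E) T1 (rep_corr F \<theta>) u"
  shows "corr_iso (adj_algebra E) T (rep_corr F \<theta>) (rep_ident E \<theta> g t)"
proof -
  interpret E: hilbert_module E by fact
  interpret F: hilbert_module F by fact
  have Fc: "correspondence (adj_algebra E) (rep_corr F \<theta>)"
    by (rule unital_rep_correspondence[OF E(1) F \<theta>])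
  have Gc: "correspondence whole_algebra G" by (rule tensor_correspondence[OF G])
  have mult: "\<theta> (a o\<^sub>L b) = \<theta> a o\<^sub>L \<theta> b" if "a \<in> adjointables E" "b \<in> adjointables E" for a b
    using \<theta> that by (simp add: unital_rep_def)
  have star: "ip F (blinfun_apply (\<theta> a) y) z = ip F y (blinfun_apply (\<theta> (adj E a)) z)"
    if "a \<in> adjointables E" for a y z
    using correspondence.lact_star[OF Fc] that by simp
  let ?G = "{(t x1 (g (Dual x2) y), blinfun_apply (\<theta> (rank_one E x1 x2)) y) | x1 x2 y. True}"
  have 1: "closed_cspan (fst ` ?G) = UNIV"
  proof (rule total_trans[OF tensor_total[OF T]])
    fix w assume "w \<in> {t x y | x y. True}"
    then obtain x m where w: "w = t x m" by blast
    have "m \<in> closed_cspan {g x y | x y. True}" using tensor_total[OF G] by simp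
    then show "w \<in> closed_cspan (fst ` ?G)"
      unfolding w
    proof (rule closed_cspan_image[OF op_tensor_clinear[OF T Gc]])
      fix m' assume "m' \<in> {g x y | x y. True}"
      then obtain z y where "m' = g z y" by blast
      then have "m' = g (Dual (undual z)) y" by (simp add: undual_inverse)
      then show "t x m' \<in> closed_cspan (fst ` ?G)" by (intro closed_cspan_base) force
    qed
  qed
  have uu: "unitary T1 (rep_corr F \<theta>) u"
    and ul: "\<And>a m. a \<in> adjointables E \<Longrightarrow> u (lact T1 a m) = blinfun_apply (\<theta> a) (u m)"
    using u by (auto simp: corr_iso_def)
  have ulin: "clinear_bounded u"
    by (rule unitary_clinear_bounded[OF tensor_hilbert_module[OF T1] hilbert_module_rep_corr[OF F] uu])
  have 2: "closed_cspan (snd ` ?G) = UNIV"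
  proof (rule total_image[OF tensor_total[OF T1] ulin])
    show "surj u" using uu by (simp add: unitary_def)
    fix w assume "w \<in> {t1 x y | x y. True}"
    then obtain x m where w: "w = t1 x m" by blast
    have "m \<in> closed_cspan {lact F1 (ip E x x') y | x x' y. True}"
      using total_pairing_action[OF F1 E(2)] by simp
    then show "u w \<in> closed_cspan (snd ` ?G)"
      unfolding w
    proof (rule closed_cspan_image[OF clinear_bounded_compose[OF ulin op_tensor_clinear[OF T1 F1]]])
      fix m' assume "m' \<in> {lact F1 (ip E x x') y | x x' y. True}"
      then obtain z x' y where m': "m' = lact F1 (ip E z x') y" by blast
      have "u (t1 x m') = blinfun_apply (\<theta> (rank_one E x z)) (u (t1 x' y))"
        unfolding m' lact_rank_one[OF E(1) T1 F1, symmetric] by (rule ul[OF E.rank_one_adjointable])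
      then show "u (t1 x m') \<in> closed_cspan (snd ` ?G)" by (intro closed_cspan_base) force
    qed
  qed
  have ip: "ip F (blinfun_apply (\<theta> (rank_one E x1 x2)) y) (blinfun_apply (\<theta> (rank_one E z1 z2)) y') =
      ip T (t x1 (g (Dual x2) y)) (t z1 (g (Dual z2) y'))" for x1 x2 y z1 z2 y'
  proof -
    have "rank_one E x2 x1 o\<^sub>L rank_one E z1 z2 = rank_one E x2 (ract E z2 (star (ip E x1 z1)))"
      by (rule blinfun_eqI)
         (simp add: E.rank_one_apply E.ip_ract E.ip_ract_left star_star E.ract_mult)
    then show ?thesis
      by (simp add: tensor_ip[OF T] tensor_lact[OF G] tensor_ip[OF G] star E.rank_one_adjointable
          E.adj_rank_one flip: mult blinfun_apply_blinfun_compose)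
  qed
  have 3: "ip (rep_corr F \<theta>) n n' = ip T m m'" if "(m, n) \<in> ?G" "(m', n') \<in> ?G" for m n m' n'
    using that ip by auto
  note * = map_given_by_unitary[OF tensor_hilbert_module[OF T] hilbert_module_rep_corr[OF F] 1 2 3]
  have un: "unitary T (rep_corr F \<theta>) (rep_ident E \<theta> g t)"
    unfolding rep_ident_def by (rule *(1))
  have ap: "rep_ident E \<theta> g t (t x1 (g (Dual x2) y)) = blinfun_apply (\<theta> (rank_one E x1 x2)) y" for x1 x2 y
    unfolding rep_ident_def by (rule *(2)) auto
  have lin: "clinear_bounded (rep_ident E \<theta> g t)"
    by (rule unitary_clinear_bounded[OF tensor_hilbert_module[OF T] hilbert_module_rep_corr[OF F] un])
  have "rep_ident E \<theta> g t (lact T a m) = blinfun_apply (\<theta> a) (rep_ident E \<theta> g t m)"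
    if a: "a \<in> adjointables E" for a m
  proof (rule clinear_bounded_eq_on_total[OF _ _ 1])
    show "clinear_bounded (\<lambda>m. rep_ident E \<theta> g t (lact T a m))"
      using correspondence.clinear_bounded_lact[OF tensor_correspondence[OF T] banach_star_algebra_adj[OF E(1)]] a
      by (intro clinear_bounded_compose[OF lin]) simp
    show "clinear_bounded (\<lambda>m. blinfun_apply (\<theta> a) (rep_ident E \<theta> g t m))"
      using correspondence.clinear_bounded_lact[OF Fc banach_star_algebra_adj[OF E(1)], of a] a
      by (intro clinear_bounded_compose[OF _ lin]) simp
    fix m assume "m \<in> fst ` ?G"
    then obtain x1 x2 y where m: "m = t x1 (g (Dual x2) y)" by auto
    have "a o\<^sub>L rank_one E x1 x2 = rank_one E (blinfun_apply a x1) x2"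
    proof (rule blinfun_eqI)
      fix z
      have "blinfun_apply a (ract E x b) = ract E (blinfun_apply a x) b" for x b
        by (rule E.eq_by_ip) (simp add: E.adj_right[OF a] E.ip_ract)
      then show "blinfun_apply (a o\<^sub>L rank_one E x1 x2) z = blinfun_apply (rank_one E (blinfun_apply a x1) x2) z"
        by (simp add: E.rank_one_apply)
    qed
    then show "rep_ident E \<theta> g t (lact T a m) = blinfun_apply (\<theta> a) (rep_ident E \<theta> g t m)"
      using mult[OF a E.rank_one_adjointable, of x1 x2] a by (simp add: m tensor_lact[OF T] ap)
  qed
  then show ?thesis using un by (simp add: corr_iso_def)
qed

lemma corr_iso_inv_comp:
  assumes M: "hilbert_module M" and u: "corr_iso A L N u" and \<iota>: "corr_iso A M N \<iota>"
  shows "corr_iso A L M (inv \<iota> \<circ> u)"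
proof -
  have un: "unitary M N \<iota>" using \<iota> by (simp add: corr_iso_def)
  have b: "bij \<iota>" by (rule unitary_bij[OF M un])
  have eq: "inv \<iota> (lact N a y) = lact M a (inv \<iota> y)" if "a \<in> acarrier A" for a y
  proof -
    have "\<iota> (lact M a (inv \<iota> y)) = lact N a y"
      using \<iota> that b by (simp add: corr_iso_def bij_is_surj surj_f_inv_f)
    then show ?thesis using b by (metis bij_inv_eq_iff)
  qed
  have "unitary L M (inv \<iota> \<circ> u)"
    using u by (intro unitary_comp[OF _ unitary_inv[OF M un]]) (simp add: corr_iso_def)
  then show ?thesis
    using u eq by (simp add: corr_iso_def)
qed

theorem theorem1p8:
  fixes E :: "('e::complex_banach, 'b::cstar_algebra) hilbert_mod"
    and P :: "('p::complex_banach, 'b, 'b) corr"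
    and F1 :: "('f1::complex_banach, 'c::cstar_algebra, 'b) corr"
    and T1 :: "('t1::complex_banach, 'c, 'e \<Rightarrow>\<^sub>L 'e) corr"
    and S1 :: "('s1::complex_banach, 'c, 'b) corr"
    and Q1 :: "('q1::complex_banach, 'c, 'b) corr"
    and R1 :: "('r1::complex_banach, 'c, 'b) corr"
    and F2 :: "('f2::complex_banach, 'c, 'b) corr"
    and T2 :: "('t2::complex_banach, 'c, 'e \<Rightarrow>\<^sub>L 'e) corr"
    and S2 :: "('s2::complex_banach, 'c, 'b) corr"
    and Q2 :: "('q2::complex_banach, 'c, 'b) corr"
    and R2 :: "('r2::complex_banach, 'c, 'b) corr"
    and F :: "('f::complex_banach, 'c) hilbert_mod"
    and \<theta> :: "('e \<Rightarrow>\<^sub>L 'e) \<Rightarrow> ('f \<Rightarrow>\<^sub>L 'f)"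
    and F\<theta> :: "('g::complex_banach, 'c, 'b) corr"
    and T\<theta> :: "('t3::complex_banach, 'c, 'e \<Rightarrow>\<^sub>L 'e) corr"
    and S\<theta> :: "('s3::complex_banach, 'c, 'b) corr"
    and Q\<theta> :: "('q3::complex_banach, 'c, 'b) corr"
    and R\<theta> :: "('r3::complex_banach, 'c, 'b) corr"
    and u :: "'t1 \<Rightarrow> 't2" and u' :: "'t1 \<Rightarrow> 'f"
  assumes E: "hilbert_module E" "full E"
    and P: "tensor_product whole_algebra (dual_corr E) (op_corr E) P p"
    and F1: "correspondence whole_algebra F1"
    and chain1: "tensor_chain E P F1 T1 t1 S1 s1 Q1 q1 R1 r1"
  shows
    "(correspondence whole_algebra F2 \<longrightarrow>
      tensor_chain E P F2 T2 t2 S2 s2 Q2 q2 R2 r2 \<longrightarrow>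
      corr_iso (adj_algebra E) T1 T2 u \<longrightarrow>
      (let v = induced_map E p F1 t1 s1 q1 r1 F2 t2 s2 q2 r2 u in
        corr_iso whole_algebra F1 F2 v \<and>
        tensor_map t1 t2 id v = u \<and>
        (\<forall>w. corr_iso whole_algebra F1 F2 w \<and> tensor_map t1 t2 id w = u \<longrightarrow> w = v)))
     \<and>
     (hilbert_module F \<longrightarrow> unital_rep E F \<theta> \<longrightarrow> strict E F \<theta> \<longrightarrow>
      tensor_product whole_algebra (dual_corr E) (rep_corr F \<theta>) F\<theta> g \<longrightarrow>
      tensor_chain E P F\<theta> T\<theta> t\<theta> S\<theta> s\<theta> Q\<theta> q\<theta> R\<theta> r\<theta> \<longrightarrow>
      corr_iso (adj_algebra E) T1 (rep_corr F \<theta>) u' \<longrightarrow>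
      (let \<iota> = rep_ident E \<theta> g t\<theta>;
           v = induced_map E p F1 t1 s1 q1 r1 F\<theta> t\<theta> s\<theta> q\<theta> r\<theta> (inv \<iota> \<circ> u') in
        corr_iso whole_algebra F1 F\<theta> v \<and>
        \<iota> \<circ> tensor_map t1 t\<theta> id v = u' \<and>
        (\<forall>w. corr_iso whole_algebra F1 F\<theta> w \<and> \<iota> \<circ> tensor_map t1 t\<theta> id w = u' \<longrightarrow> w = v)))"
  (is "(_ \<longrightarrow> _ \<longrightarrow> _ \<longrightarrow> ?first) \<and> (_ \<longrightarrow> _ \<longrightarrow> _ \<longrightarrow> _ \<longrightarrow> _ \<longrightarrow> _ \<longrightarrow> ?second)")
proof (intro conjI impI)
  assume "correspondence whole_algebra F2" "tensor_chain E P F2 T2 t2 S2 s2 Q2 q2 R2 r2"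
    "corr_iso (adj_algebra E) T1 T2 u"
  note * = induced_isomorphism[OF E P F1 chain1 this]
  show ?first
    unfolding Let_def using * by blast
next
  assume F: "hilbert_module F" and \<theta>: "unital_rep E F \<theta>"
    and G: "tensor_product whole_algebra (dual_corr E) (rep_corr F \<theta>) F\<theta> g"
    and chain: "tensor_chain E P F\<theta> T\<theta> t\<theta> S\<theta> s\<theta> Q\<theta> q\<theta> R\<theta> r\<theta>"
    and u': "corr_iso (adj_algebra E) T1 (rep_corr F \<theta>) u'"
  have T1: "tensor_product (adj_algebra E) (op_corr E) F1 T1 t1"
    and T: "tensor_product (adj_algebra E) (op_corr E) F\<theta> T\<theta> t\<theta>"
    using chain1 chain by (auto simp: tensor_chain_def)
  define \<iota> where "\<iota> = rep_ident E \<theta> g t\<theta>"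
  have \<iota>: "corr_iso (adj_algebra E) T\<theta> (rep_corr F \<theta>) \<iota>"
    unfolding \<iota>_def by (rule rep_ident_corr_iso[OF E F1 T1 F \<theta> G T u'])
  have hm: "hilbert_module T\<theta>" by (rule tensor_hilbert_module[OF T])
  have bij: "bij \<iota>" using unitary_bij[OF hm] \<iota> by (auto simp: corr_iso_def)
  note * = induced_isomorphism[OF E P F1 chain1 tensor_correspondence[OF G] chain
      corr_iso_inv_comp[OF hm u' \<iota>]]
  have eq: "\<iota> \<circ> k = u' \<longleftrightarrow> k = inv \<iota> \<circ> u'" for k
    using bij_inv_eq_iff[OF bij] by (auto simp: fun_eq_iff)
  show ?second
    unfolding Let_def \<iota>_def[symmetric] eq using * by blast
qed

end
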